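(* Let $d\ge1$, $T,\epsilon>0$ and $x\in\mathbb R^d$, and define $u_x^*(t):=\operatorname{sgn}(Y_x^{+}(t))$ and $v_x^*(t):=-\operatorname{sgn}(Y_x^{-}(t))$. For $u\in\mathcal A$ put $X_u(t):=x+\int_0^t u(s)\,ds+W(t)$. Then $$\inf_{u\in\mathcal A}P(|X_u(T)|\le\epsilon)=P(|X_{u_x^*}(T)|\le\epsilon),$$ i.e. $u_x^*$ is an optimal control for this minimisation problem, and similarly $$\sup_{v\in\mathcal A}P(|X_v(T)|\le\epsilon)=P(|X_{v_x^*}(T)|\le\epsilon).$$
   Context: $(\Omega,(\mathcal F_t)_{t\ge0},\mathfrak A,P)$ is a filtered probability space with the usual conditions ($\mathcal F_0$ contains all $P$-null sets and the filtration is right-continuous) and $W$ is a $d$-dimensional standard $(\mathcal F_t)$-Brownian motion. $\mathcal A$ is the set of all $\mathbb R^d$-valued (jointly measurable) $(\mathcal F_t)$-adapted stochastic processes bounded by $1$ in Euclidean norm $|\cdot|$. For $y\in\mathbb R^d$, $\operatorname{sgn}(y):=y/|y|$ if $y\neq0$ and $\operatorname{sgn}(0):=0$. For $x\in\mathbb R^d$, $Y_x^{\pm}$ is the unique solution of $Y_x^{\pm}(t)=x\pm\int_0^t\operatorname{sgn}(Y_x^{\pm}(s))\,ds+W(t)$, $t\ge0$. *)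

theory Defs
  imports "HOL-Probability.Probability"
begin

text \<open>
  Time is \<open>[0, \<infinity>)\<close>, represented by the nonnegative reals: values of filtrations and processes at
  negative times are junk and never constrained. (The library locale \<open>filtration\<close> would constrain
  the whole index type.)
\<close>

text \<open>
  Only the measurable \<open>P\<close>-null sets are required to lie in \<open>F 0\<close>. If \<open>P\<close> is moreover complete,
  these are all subsets of null sets; completeness itself is not assumed.
\<close>

locale usual_filtered_prob_space = prob_space M
  for M :: "'a measure" +
  fixes F :: "real \<Rightarrow> 'a measure"
  assumes subalgebra_F: "\<And>t. 0 \<le> t \<Longrightarrow> subalgebra M (F t)"
    and mono_F: "\<And>s t. 0 \<le> s \<Longrightarrow> s \<le> t \<Longrightarrow> sets (F s) \<subseteq> sets (F t)"
    and null_sets_F: "null_sets M \<subseteq> sets (F 0)"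
    and right_continuous_F: "\<And>t. 0 \<le> t \<Longrightarrow> sets (F t) = (\<Inter>s\<in>{t<..}. sets (F s))"

definition adapted :: "(real \<Rightarrow> 'a measure) \<Rightarrow> (real \<Rightarrow> 'a \<Rightarrow> 'b::topological_space) \<Rightarrow> bool" where
  "adapted F X \<longleftrightarrow> (\<forall>t\<ge>0. X t \<in> borel_measurable (F t))"

definition jointly_measurable :: "'a measure \<Rightarrow> (real \<Rightarrow> 'a \<Rightarrow> 'b::topological_space) \<Rightarrow> bool" where
  "jointly_measurable M X \<longleftrightarrow>
     (\<lambda>(t, \<omega>). X t \<omega>) \<in> borel_measurable (restrict_space borel {0..} \<Otimes>\<^sub>M M)"

text \<open>
  The density below is that of \<open>N(0, (t - s) I)\<close>; the second argument of \<^const>\<open>normal_density\<close>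
  is the standard deviation.
\<close>

locale brownian_motion = usual_filtered_prob_space M F
  for M :: "'a measure" and F :: "real \<Rightarrow> 'a measure" +
  fixes W :: "real \<Rightarrow> 'a \<Rightarrow> real ^ 'd::finite"
  assumes adapted_W: "adapted F W"
    and start_W: "AE \<omega> in M. W 0 \<omega> = 0"
    and continuous_W: "AE \<omega> in M. continuous_on {0..} (\<lambda>t. W t \<omega>)"
    and indep_increments_W: "\<And>s t. 0 \<le> s \<Longrightarrow> s < t \<Longrightarrow>
      indep_set (sets (F s)) {(\<lambda>\<omega>. W t \<omega> - W s \<omega>) -` B \<inter> space M | B. B \<in> sets borel}"
    and normal_increments_W: "\<And>s t. 0 \<le> s \<Longrightarrow> s < t \<Longrightarrow>
      distributed M lborel (\<lambda>\<omega>. W t \<omega> - W s \<omega>)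
        (\<lambda>z. ennreal (\<Prod>i\<in>UNIV. normal_density 0 (sqrt (t - s)) (z $ i)))"

definition admissible_controls ::
  "'a measure \<Rightarrow> (real \<Rightarrow> 'a measure) \<Rightarrow> (real \<Rightarrow> 'a \<Rightarrow> real ^ 'd::finite) set" where
  "admissible_controls M F =
     {u. jointly_measurable M u \<and> adapted F u \<and> (\<forall>t\<ge>0. \<forall>\<omega>\<in>space M. norm (u t \<omega>) \<le> 1)}"

definition controlled_process ::
  "(real \<Rightarrow> 'a \<Rightarrow> real ^ 'd::finite) \<Rightarrow> real ^ 'd \<Rightarrow> (real \<Rightarrow> 'a \<Rightarrow> real ^ 'd) \<Rightarrow> real \<Rightarrow> 'a \<Rightarrow> real ^ 'd"
  where
  "controlled_process W x u t \<omega> = x + set_lebesgue_integral lborel {0..t} (\<lambda>s. u s \<omega>) + W t \<omega>"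

text \<open>
  Solutions of \<open>Y(t) = x + c \<integral>\<^sub>0\<^sup>t sgn (Y(s)) ds + W(t)\<close>, used with \<open>c = 1\<close> and \<open>c = - 1\<close>. The
  overloaded \<^const>\<open>sgn\<close> on \<open>real ^ 'd\<close> is \<open>y / |y|\<close>, and \<open>0\<close> at \<open>0\<close>. Almost sure path continuity
  follows from the equation and is therefore not listed.
\<close>

definition sgn_sde_solution ::
  "'a measure \<Rightarrow> (real \<Rightarrow> 'a measure) \<Rightarrow> (real \<Rightarrow> 'a \<Rightarrow> real ^ 'd::finite) \<Rightarrow> real \<Rightarrow> real ^ 'd \<Rightarrow>
    (real \<Rightarrow> 'a \<Rightarrow> real ^ 'd) \<Rightarrow> bool" where
  "sgn_sde_solution M F W c x Y \<longleftrightarrow> jointly_measurable M Y \<and> adapted F Y \<and>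
     (AE \<omega> in M. \<forall>t\<ge>0.
        Y t \<omega> = x + c *\<^sub>R set_lebesgue_integral lborel {0..t} (\<lambda>s. sgn (Y s \<omega>)) + W t \<omega>)"

end

theory Submission
  imports Defs
begin

text \<open>
  The proof is a verification argument by dynamic programming in discrete time.

  Fix a function \<open>f\<close> that is Lipschitz, takes values in \<open>[0, 1]\<close> and is radially decreasing, and let
  \<open>c = 1\<close> for the minimisation and \<open>c = - 1\<close> for the maximisation of the expectation of
  \<open>f (X T)\<close>. Cut \<open>[0, T]\<close> into \<open>n\<close> steps of length \<open>h\<close>. If the drift of a step, a vector of norm at most
  \<open>h\<close>, has to be chosen at the start of the step, the problem has an explicit solution. Gaussian smoothing
  preserves radially decreasing functions (\<open>radially_decreasing_convolution\<close>, a reflection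
  argument), so at each step it is best to change the norm of the state by \<open>c * h\<close>, as far as
  possible; the new value function \<open>radial_step c h f\<close> is again radially decreasing, with the same Lipschitz
  constant.

  It remains to compare this discrete value with the continuous problem from both sides.

  No control beats it by more than \<open>L * h\<close> (\<open>radial_value_bounds_controlled\<close>): delay the drift of
  an arbitrary control by one step. The delayed drift is known at the start of the step in which it is
  used, and only the drift of the last step is lost.

  The feedback control attains it in the limit (\<open>radial_value_close_to_feedback\<close>): the feedback drift
  differs from the discretely optimal one only where the state is close to the origin or where
  \<open>sgn (Y s)\<close> has changed since the last grid point. As the Lipschitz constant is the same at all steps,
  the errors add up to at most \<open>L\<close> times a time integral, and this tends to 0 by dominated convergence,
  since the paths of \<open>Y\<close> are continuous and \<open>Y s \<noteq> 0\<close> almost surely for each \<open>s > 0\<close>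
  (\<open>controlled_process_nonzero\<close>).

  Letting \<open>n\<close> tend to infinity gives optimality for every such \<open>f\<close>, and letting \<open>f\<close> decrease to the
  indicator of the closed ball of radius \<open>\<epsilon>\<close> gives the theorem.
\<close>

section \<open>Invariance of Lebesgue measure under linear isometries\<close>

text \<open>
  The functional \<open>f \<mapsto> \<integral> f (R x) dx\<close> is translation invariant because \<open>R\<close> is linear and onto, so it
  is a multiple of \<open>\<integral> f\<close>: compare the two by evaluating \<open>\<integral>\<integral> f (R x) g (y - R x) dy dx\<close> in both
  orders. With \<open>g\<close> the indicator of the unit ball, which \<open>R\<close> and \<open>x \<mapsto> - x\<close> both fix, the factor is 1.
\<close>

lemma orthogonal_distr_lborel:
  fixes R :: "'a::euclidean_space \<Rightarrow> 'a"
  assumes R: "orthogonal_transformation R"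
  shows "distr lborel borel R = lborel"
proof -
  have lin: "linear R" using R by (rule orthogonal_transformation_linear)
  have [measurable]: "R \<in> borel_measurable borel"
    using lin by (simp add: borel_measurable_continuous_onI linear_continuous_on linear_conv_bounded_linear)
  obtain S where S: "\<And>y. R (S y) = y"
    using orthogonal_transformation_surj[OF R] by (metis surj_def)
  let ?B = "emeasure lborel (ball (0::'a) 1)"
  define g :: "'a \<Rightarrow> ennreal" where "g = indicator (ball 0 1)"
  have [measurable]: "g \<in> borel_measurable borel"
    unfolding g_def by (intro borel_measurable_indicator) simp
  have g_int: "(\<integral>\<^sup>+x. g x \<partial>lborel) = ?B" by (simp add: g_def)
  have g_R: "g (- R x) = g x" for x
    using R by (simp add: g_def indicator_def orthogonal_transformation_norm)
  have shift: "(\<integral>\<^sup>+x. h (c + x) \<partial>lborel) = (\<integral>\<^sup>+x. h x \<partial>lborel)"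
    if [measurable]: "h \<in> borel_measurable borel" for h :: "'a \<Rightarrow> ennreal" and c
    using nn_integral_distr[of "(+) c" lborel borel h] by (simp add: lborel_distr_plus)
  have inv: "(\<integral>\<^sup>+x. f (R x) \<partial>lborel) = (\<integral>\<^sup>+x. f x \<partial>lborel)"
    if [measurable]: "f \<in> borel_measurable borel" for f :: "'a \<Rightarrow> ennreal"
  proof -
    have "(\<integral>\<^sup>+x. f (R x) \<partial>lborel) * ?B = (\<integral>\<^sup>+x. f (R x) * ?B \<partial>lborel)"
      by (simp add: nn_integral_multc)
    also have "\<dots> = (\<integral>\<^sup>+x. (\<integral>\<^sup>+y. f (R x) * g (- R x + y) \<partial>lborel) \<partial>lborel)"
    proof (rule nn_integral_cong)
      fix x
      have "(\<integral>\<^sup>+y. f (R x) * g (- R x + y) \<partial>lborel) = f (R x) * (\<integral>\<^sup>+y. g (- R x + y) \<partial>lborel)"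
        by (rule nn_integral_cmult) measurable
      then show "f (R x) * ?B = (\<integral>\<^sup>+y. f (R x) * g (- R x + y) \<partial>lborel)"
        by (subst (asm) shift) (auto simp: g_int)
    qed
    also have "\<dots> = (\<integral>\<^sup>+y. (\<integral>\<^sup>+x. f (R x) * g (- R x + y) \<partial>lborel) \<partial>lborel)"
      by (rule lborel_pair.Fubini') measurable
    also have "\<dots> = (\<integral>\<^sup>+y. (\<integral>\<^sup>+x. f (R x + y) * g (- R x) \<partial>lborel) \<partial>lborel)"
    proof (rule nn_integral_cong)
      fix y
      have "(\<integral>\<^sup>+x. f (R x) * g (- R x + y) \<partial>lborel)
          = (\<integral>\<^sup>+x. f (R (S y + x)) * g (- R (S y + x) + y) \<partial>lborel)"
        by (rule shift[symmetric]) measurable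
      then show "(\<integral>\<^sup>+x. f (R x) * g (- R x + y) \<partial>lborel)
          = (\<integral>\<^sup>+x. f (R x + y) * g (- R x) \<partial>lborel)"
        by (simp add: linear_add[OF lin] S add.commute)
    qed
    also have "\<dots> = (\<integral>\<^sup>+x. (\<integral>\<^sup>+y. f (R x + y) * g (- R x) \<partial>lborel) \<partial>lborel)"
      by (rule lborel_pair.Fubini') measurable
    also have "\<dots> = (\<integral>\<^sup>+x. (\<integral>\<^sup>+y. f y \<partial>lborel) * g x \<partial>lborel)"
      by (rule nn_integral_cong) (simp add: nn_integral_multc shift[of f] g_R)
    also have "\<dots> = (\<integral>\<^sup>+y. f y \<partial>lborel) * ?B"
      by (simp add: nn_integral_cmult g_int)
    finally show ?thesis
      using less_imp_neq[OF unit_ball_vol_pos[of "real DIM('a)"]] 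
      by (auto simp add: ennreal_mult_cancel_left emeasure_ball mult.commute[of _ "ennreal _"])
  qed
  show ?thesis
  proof (rule measure_eqI)
    fix A assume A: "A \<in> sets (distr lborel borel R)"
    then have [measurable]: "A \<in> sets borel" by simp
    have "emeasure (distr lborel borel R) A = (\<integral>\<^sup>+x. indicator A x \<partial>distr lborel borel R)"
      by simp
    also have "\<dots> = (\<integral>\<^sup>+x. indicator A (R x) \<partial>lborel)"
      by (rule nn_integral_distr) auto
    also have "\<dots> = emeasure lborel A"
      by (subst inv) auto
    finally show "emeasure (distr lborel borel R) A = emeasure lborel A" .
  qed simp
qed

section \<open>Radially decreasing functions and convolution\<close>

text \<open>
  The hypothesis ranges over all pairs with \<open>norm y \<le> norm z\<close>, in particular over pairs of equal
  norm; so it says both that the function is radial and that its profile is nonincreasing.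
\<close>

definition radially_decreasing :: "('a::real_normed_vector \<Rightarrow> real) \<Rightarrow> bool" where
  "radially_decreasing f \<longleftrightarrow> (\<forall>y z. norm y \<le> norm z \<longrightarrow> f z \<le> f y)"

lemma radially_decreasingD: "radially_decreasing f \<Longrightarrow> norm y \<le> norm z \<Longrightarrow> f z \<le> f y"
  by (auto simp: radially_decreasing_def)

text \<open>
  For \<open>norm y \<le> norm y'\<close> let \<open>R\<close> be the reflection that exchanges \<open>y\<close> and \<open>y'\<close>. It reverses the sign
  of \<open>q w = p (w - y) - p (w - y')\<close>, hence
  \<open>2 \<integral> f q = \<integral> (f w - f (R w)) q w dw\<close>. On the side of the mirror that contains \<open>y\<close>, points are at
  least as close to the origin as their mirror images (since \<open>y\<close> is at least as close as \<open>y'\<close>) and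
  closer to \<open>y\<close> than to \<open>y'\<close>: both factors are nonnegative there, and both are nonpositive on the other
  side.
\<close>

lemma radially_decreasing_convolution:
  fixes f p :: "'a::euclidean_space \<Rightarrow> real"
  assumes f: "radially_decreasing f" and p: "radially_decreasing p"
    and [measurable]: "f \<in> borel_measurable borel"
    and bdd: "\<And>w. \<bar>f w\<bar> \<le> B" and int: "integrable lborel p"
  shows "radially_decreasing (\<lambda>y. \<integral>w. f w * p (w - y) \<partial>lborel)"
  unfolding radially_decreasing_def
proof (intro allI impI)
  fix y y' :: 'a
  assume le: "norm y \<le> norm y'"
  show "(\<integral>w. f w * p (w - y') \<partial>lborel) \<le> (\<integral>w. f w * p (w - y) \<partial>lborel)"
  proof (cases "y = y'")
    case False
    define v where "v = y - y'"
    define m where "m = (1/2) *\<^sub>R (y + y')"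
    \<comment> \<open>\<open>s w\<close> is the signed offset of \<open>w\<close> from the mirror, in units of \<open>v / 2\<close>; its sign tells the side.\<close>
    define s where "s w = 2 * ((w - m) \<bullet> v) / (v \<bullet> v)" for w
    define R where "R w = w - s w *\<^sub>R v" for w
    have v: "v \<bullet> v \<noteq> 0" using False by (simp add: v_def)
    have sv: "s w * (v \<bullet> v) = 2 * ((w - m) \<bullet> v)" for w using v by (simp add: s_def)
    define R0 where "R0 w = w - (2 * (w \<bullet> v) / (v \<bullet> v)) *\<^sub>R v" for w
    have "linear R0"
      by (rule linearI) (simp_all add: R0_def inner_add_left algebra_simps add_divide_distrib)
    moreover have "norm (R0 w) = norm w" for w
    proof -
      have "R0 w \<bullet> R0 w = w \<bullet> w"
        using v by (simp add: R0_def inner_diff_left inner_diff_right inner_commute[of v w] power2_eq_square field_simps)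
      then show ?thesis by (simp add: norm_eq_sqrt_inner)
    qed
    ultimately have R0: "orthogonal_transformation R0"
      by (simp add: orthogonal_transformation)
    define c where "c = (2 * (m \<bullet> v) / (v \<bullet> v)) *\<^sub>R v"
    have R_R0: "R w = c + R0 w" for w
      by (simp add: R_def R0_def s_def c_def inner_diff_left algebra_simps diff_divide_distrib)
    have [measurable]: "R0 \<in> borel_measurable borel"
      using \<open>linear R0\<close> by (simp add: borel_measurable_continuous_onI linear_continuous_on linear_conv_bounded_linear)
    have distr_R: "distr lborel borel R = lborel"
    proof -
      have "distr lborel borel R = distr (distr lborel borel R0) borel ((+) c)"
        by (subst distr_distr) (auto simp: comp_def R_R0[abs_def] cong: distr_cong)
      then show ?thesis by (simp add: orthogonal_distr_lborel[OF R0] lborel_distr_plus)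
    qed
    have [measurable]: "R \<in> borel_measurable borel"
      unfolding R_R0[abs_def] by measurable
    have Ry: "norm (R w - y) = norm (w - y')" and Ry': "norm (R w - y') = norm (w - y)" 
      and Rn: "(norm (R w))\<^sup>2 - (norm w)\<^sup>2 = s w * ((norm y')\<^sup>2 - (norm y)\<^sup>2)" 
      and sn: "(norm (w - y'))\<^sup>2 - (norm (w - y))\<^sup>2 = s w * (v \<bullet> v)" for w
    proof -
      have e: "(R w - z) \<bullet> (R w - z) = (w - z) \<bullet> (w - z) - s w * (2 * ((w - z) \<bullet> v)) + s w * (s w * (v \<bullet> v))" for z
        by (simp add: R_def inner_diff_left inner_diff_right inner_commute algebra_simps)
      have m2: "2 * (m \<bullet> v) = y \<bullet> y - y' \<bullet> y'"
        by (simp add: m_def v_def inner_add_left inner_add_right inner_diff_right inner_diff_left inner_commute)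
      have s2: "s w * (v \<bullet> v) = 2 * (w \<bullet> v) - (y \<bullet> y - y' \<bullet> y')"
        using m2 sv[of w] by (simp add: inner_diff_left)
      have e': "(R w - z) \<bullet> (R w - z) = (w - z) \<bullet> (w - z) + s w * (2 * (z \<bullet> v) - (y \<bullet> y - y' \<bullet> y'))" for z
        unfolding e s2 by (simp add: inner_diff_left algebra_simps)
      have d: "(w - y') \<bullet> (w - y') - (w - y) \<bullet> (w - y) = s w * (v \<bullet> v)"
        unfolding s2 by (simp add: v_def inner_diff_left inner_diff_right inner_commute)
      have vv: "v \<bullet> v = y \<bullet> y - 2 * (y \<bullet> y') + y' \<bullet> y'"
        by (simp add: v_def inner_diff_left inner_diff_right inner_commute)
      have "(R w - y) \<bullet> (R w - y) = (w - y') \<bullet> (w - y')"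
        using d e'[of y] by (simp add: vv) (simp add: v_def inner_diff_left inner_diff_right inner_commute algebra_simps)
      then show "norm (R w - y) = norm (w - y')" by (simp add: norm_eq_sqrt_inner)
      have "(R w - y') \<bullet> (R w - y') = (w - y) \<bullet> (w - y)"
        using d e'[of y'] by (simp add: vv) (simp add: v_def inner_diff_left inner_diff_right inner_commute algebra_simps)
      then show "norm (R w - y') = norm (w - y)" by (simp add: norm_eq_sqrt_inner)
      show "(norm (R w))\<^sup>2 - (norm w)\<^sup>2 = s w * ((norm y')\<^sup>2 - (norm y)\<^sup>2)" 
        using e'[of 0] by (simp add: power2_norm_eq_inner algebra_simps)
      show "(norm (w - y'))\<^sup>2 - (norm (w - y))\<^sup>2 = s w * (v \<bullet> v)"
        using d by (simp add: power2_norm_eq_inner)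
    qed
    define q where "q w = p (w - y) - p (w - y')" for w
    have p_shift: "integrable lborel (\<lambda>w. p (w - z))" for z
    proof -
      have "integrable (distr lborel borel ((+) (- z))) p" 
        using int by (simp add: lborel_distr_plus)
      then have "integrable lborel (\<lambda>w. p (- z + w))"
        by (subst (asm) integrable_distr_eq) (use int in auto)
      then show ?thesis by (simp add: add.commute)
    qed
    have fp: "integrable lborel (\<lambda>w. f (g w) * p (w - z))" 
      if [measurable]: "g \<in> borel_measurable borel" for g z
      by (rule Bochner_Integration.integrable_bound[OF integrable_mult_right[OF integrable_norm[OF p_shift[of z]], of B]])
         (use p_shift[of z, THEN borel_measurable_integrable] in \<open>auto simp: abs_mult intro!: mult_right_mono order_trans[OF bdd abs_ge_self]\<close>)
    have fq: "integrable lborel (\<lambda>w. f (g w) * q w)" if "g \<in> borel_measurable borel" for g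
      using fp[OF that, of y] fp[OF that, of y'] by (simp add: q_def right_diff_distrib)
    have p_eq: "p a = p b" if "norm a = norm b" for a b
      using that by (intro antisym radially_decreasingD[OF p]) auto
    have qR: "q (R w) = - q w" for w
      unfolding q_def using p_eq[OF Ry[of w]] p_eq[OF Ry'[of w]] by simp
    have [measurable]: "p \<in> borel_measurable borel" using int by auto
    have "(\<integral>w. f w * q w \<partial>lborel) = (\<integral>w. f w * q w \<partial>distr lborel borel R)"
      by (simp add: distr_R)
    also have "\<dots> = (\<integral>w. f (R w) * q (R w) \<partial>lborel)"
      by (rule integral_distr) (auto simp: q_def)
    finally have I: "(\<integral>w. f w * q w \<partial>lborel) = - (\<integral>w. f (R w) * q w \<partial>lborel)"
      by (simp add: qR)
    have "0 \<le> (\<integral>w. (f w - f (R w)) * q w \<partial>lborel)"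
    proof (rule integral_nonneg_AE, rule AE_I2)
      fix w
      show "0 \<le> (f w - f (R w)) * q w"
      proof (cases "0 \<le> s w")
        case True
        have "0 \<le> s w * ((norm y')\<^sup>2 - (norm y)\<^sup>2)" "0 \<le> s w * (v \<bullet> v)"
          using True le by (auto intro!: mult_nonneg_nonneg)
        then have "norm w \<le> norm (R w)" "norm (w - y) \<le> norm (w - y')"
          using Rn[of w] sn[of w] by - (rule power2_le_imp_le, linarith, simp)+
        then show ?thesis using f p by (auto simp: q_def intro!: mult_nonneg_nonneg dest: radially_decreasingD)
      next
        case False
        have "s w * ((norm y')\<^sup>2 - (norm y)\<^sup>2) \<le> 0" "s w * (v \<bullet> v) \<le> 0"
          using False le by (auto intro!: mult_nonpos_nonneg)
        then have "norm (R w) \<le> norm w" "norm (w - y') \<le> norm (w - y)"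
          using Rn[of w] sn[of w] by - (rule power2_le_imp_le, linarith, simp)+
        then show ?thesis using f p by (auto simp: q_def intro!: mult_nonpos_nonpos dest: radially_decreasingD)
      qed
    qed
    also have "\<dots> = (\<integral>w. f w * q w \<partial>lborel) - (\<integral>w. f (R w) * q w \<partial>lborel)"
      using fq[of "\<lambda>w. w"] fq[of R] by (simp add: left_diff_distrib)
    also have "\<dots> = 2 * (\<integral>w. f w * q w \<partial>lborel)" using I by simp
    also have "(\<integral>w. f w * q w \<partial>lborel) = (\<integral>w. f w * p (w - y) \<partial>lborel) - (\<integral>w. f w * p (w - y') \<partial>lborel)"
      using fp[of "\<lambda>w. w" y] fp[of "\<lambda>w. w" y'] by (simp add: q_def right_diff_distrib)
    finally show ?thesis by simp
  qed simp
qed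

section \<open>Gaussian smoothing and one step of dynamic programming\<close>

definition gauss_kernel :: "real \<Rightarrow> real ^ 'd::finite \<Rightarrow> real" where
  "gauss_kernel h z = (\<Prod>i\<in>UNIV. normal_density 0 (sqrt h) (z $ i))"

lemma borel_measurable_gauss_kernel [measurable]: "gauss_kernel h \<in> borel_measurable borel"
  unfolding gauss_kernel_def[abs_def] by measurable

lemma gauss_kernel_eq:
  fixes z :: "real ^ 'd::finite"
  assumes "0 < h"
  shows "gauss_kernel h z = (1 / sqrt (2 * pi * h)) ^ CARD('d) * exp (- (norm z)\<^sup>2 / (2 * h))"
proof -
  have "(norm z)\<^sup>2 = (\<Sum>i\<in>UNIV. (z $ i)\<^sup>2)"
    by (simp add: norm_vec_def L2_set_def sum_nonneg)
  then show ?thesis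
    using assms by (simp add: gauss_kernel_def normal_density_def prod.distrib prod_dividef
      exp_sum[symmetric] sum_negf sum_divide_distrib power_one_over)
qed

lemma gauss_kernel_nonneg: "0 \<le> gauss_kernel h z"
  by (simp add: gauss_kernel_def prod_nonneg)

lemma gauss_kernel_le:
  fixes z :: "real ^ 'd::finite"
  assumes "0 < h"
  shows "gauss_kernel h z \<le> (1 / sqrt (2 * pi * h)) ^ CARD('d)"
  unfolding gauss_kernel_eq[OF assms] using assms by (intro mult_left_le) auto

lemma radially_decreasing_gauss_kernel:
  assumes "0 < h"
  shows "radially_decreasing (gauss_kernel h :: real ^ 'd::finite \<Rightarrow> real)"
  unfolding radially_decreasing_def gauss_kernel_eq[OF assms]
  using assms by (auto intro!: mult_left_mono divide_right_mono power_mono)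

lemma nn_integral_gauss_kernel:
  assumes "0 < h"
  shows "(\<integral>\<^sup>+z. ennreal (gauss_kernel h (z :: real ^ 'd::finite)) \<partial>lborel) = 1"
proof -
  have inj: "inj (\<lambda>i. axis i 1 :: real ^ 'd)" by (rule injI) (simp add: axis_eq_axis)
  have Basis: "(Basis :: (real ^ 'd) set) = range (\<lambda>i. axis i 1)"
    by (auto simp: Basis_vec_def)
  have "(\<integral>\<^sup>+z. ennreal (gauss_kernel h (z :: real ^ 'd)) \<partial>lborel)
      = (\<integral>\<^sup>+z. (\<Prod>b\<in>Basis. ennreal (normal_density 0 (sqrt h) (z \<bullet> b))) \<partial>(lborel :: (real ^ 'd) measure))"
    by (simp add: Basis prod.reindex[OF inj] gauss_kernel_def prod_ennreal comp_def inner_axis)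
  also have "\<dots> = (\<Prod>b\<in>(Basis :: (real ^ 'd) set). \<integral>\<^sup>+t. ennreal (normal_density 0 (sqrt h) t) \<partial>lborel)"
    by (rule nn_integral_lborel_prod) auto
  also have "(\<integral>\<^sup>+t. ennreal (normal_density 0 (sqrt h) t) \<partial>lborel) = 1"
    using integrable_normal_density[of "sqrt h" 0] integral_normal_density[of "sqrt h" 0] assms
    by (subst nn_integral_eq_integral) auto
  finally show ?thesis by simp
qed

lemma integrable_gauss_kernel: "0 < h \<Longrightarrow> integrable lborel (gauss_kernel h :: real ^ 'd::finite \<Rightarrow> real)"
  using nn_integral_gauss_kernel[of h, where 'd='d]
  by (intro integrableI_nonneg) (auto simp: gauss_kernel_nonneg)

lemma integral_gauss_kernel: "0 < h \<Longrightarrow> (\<integral>z. gauss_kernel h (z :: real ^ 'd::finite) \<partial>lborel) = 1"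
  using nn_integral_gauss_kernel[of h, where 'd='d]
  by (subst integral_eq_nn_integral) (auto simp: gauss_kernel_nonneg)

definition gauss_smooth :: "real \<Rightarrow> (real ^ 'd::finite \<Rightarrow> real) \<Rightarrow> real ^ 'd \<Rightarrow> real" where
  "gauss_smooth h f y = (\<integral>z. gauss_kernel h z * f (y + z) \<partial>lborel)"

lemma integrable_gauss_smooth:
  fixes f :: "real ^ 'd::finite \<Rightarrow> real"
  assumes "0 < h" and [measurable]: "f \<in> borel_measurable borel" and "\<And>y. \<bar>f y\<bar> \<le> B"
  shows "integrable lborel (\<lambda>z. gauss_kernel h z * f (y + z))"
  by (rule Bochner_Integration.integrable_bound[OF integrable_mult_right[OF integrable_gauss_kernel[OF \<open>0 < h\<close>], of B]])
     (auto simp: abs_mult gauss_kernel_nonneg mult.commute[of B] intro!: mult_left_mono order_trans[OF assms(3) abs_ge_self])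

text \<open>
  In this form the smoothed function is a convolution of two radially decreasing functions.
\<close>

lemma gauss_smooth_convolution:
  fixes f :: "real ^ 'd::finite \<Rightarrow> real"
  assumes [measurable]: "f \<in> borel_measurable borel"
  shows "gauss_smooth h f y = (\<integral>w. f w * gauss_kernel h (w - y) \<partial>lborel)"
proof -
  have "(\<integral>w. f w * gauss_kernel h (w - y) \<partial>lborel)
      = (\<integral>w. f w * gauss_kernel h (w - y) \<partial>distr lborel borel ((+) y))"
    by (simp add: lborel_distr_plus)
  also have "\<dots> = (\<integral>w. f (y + w) * gauss_kernel h (y + w - y) \<partial>lborel)"
    by (rule integral_distr) auto
  finally show ?thesis by (simp add: gauss_smooth_def mult.commute)
qed

text \<open>
  The functions that arise as value functions. Unlike smoothness, the Lipschitz constant does not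
  deteriorate under a dynamic programming step, so one \<open>L\<close> serves every step of every time
  discretisation; the errors of the steps can therefore simply be added.
\<close>

definition value_profile :: "real \<Rightarrow> (real ^ 'd::finite \<Rightarrow> real) \<Rightarrow> bool" where
  "value_profile L f \<longleftrightarrow>
     radially_decreasing f \<and> (\<forall>y z. \<bar>f y - f z\<bar> \<le> L * norm (y - z)) \<and> (\<forall>y. 0 \<le> f y \<and> f y \<le> 1)"

lemma
  assumes "value_profile L f"
  shows value_profile_mono: "norm y \<le> norm z \<Longrightarrow> f z \<le> f y"
    and value_profile_lipschitz: "\<bar>f y - f z\<bar> \<le> L * norm (y - z)"
    and value_profile_nonneg: "0 \<le> f y" and value_profile_le_1: "f y \<le> 1"
    and value_profile_abs_le_1: "\<bar>f y\<bar> \<le> 1"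
  using assms by (auto simp: value_profile_def dest: radially_decreasingD intro: abs_leI)

lemma borel_measurable_value_profile:
  assumes "value_profile L f"
  shows "f \<in> borel_measurable borel"
proof (rule borel_measurable_continuous_onI)
  have "\<bar>L\<bar>-lipschitz_on UNIV f"
    using assms by (intro lipschitz_onI) (auto simp: dist_norm intro: order_trans[OF value_profile_lipschitz mult_right_mono])
  then show "continuous_on UNIV f" by (rule lipschitz_on_continuous_on)
qed

lemma gauss_smooth_value_profile:
  fixes f :: "real ^ 'd::finite \<Rightarrow> real"
  assumes f: "value_profile L f" and h: "0 < h"
  shows "value_profile L (gauss_smooth h f)"
  unfolding value_profile_def
proof (intro conjI allI)
  have [measurable]: "f \<in> borel_measurable borel" by (rule borel_measurable_value_profile[OF f])
  note int = integrable_gauss_smooth[OF h, of f 1, OF \<open>f \<in> borel_measurable borel\<close> value_profile_abs_le_1[OF f]]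
  note k = integrable_gauss_kernel[OF h, where 'd='d] integral_gauss_kernel[OF h, where 'd='d]
  show "radially_decreasing (gauss_smooth h f)"
    unfolding gauss_smooth_convolution[OF \<open>f \<in> borel_measurable borel\<close>, abs_def]
    using f by (intro radially_decreasing_convolution[where B=1] radially_decreasing_gauss_kernel h
      integrable_gauss_kernel value_profile_abs_le_1[OF f]) (auto simp: value_profile_def)
  fix y z :: "real ^ 'd"
  have "gauss_smooth h f y - gauss_smooth h f z
      = (\<integral>w. gauss_kernel h w * (f (y + w) - f (z + w)) \<partial>lborel)"
    unfolding gauss_smooth_def by (simp add: right_diff_distrib int)
  also have "\<bar>\<dots>\<bar> \<le> (\<integral>w. gauss_kernel h w * (L * norm (y - z)) \<partial>(lborel :: (real ^ 'd) measure))"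
  proof (rule integral_abs_bound_integral)
    show "integrable lborel (\<lambda>w. gauss_kernel h w * (f (y + w) - f (z + w)))"
      by (simp add: right_diff_distrib int)
    show "integrable lborel (\<lambda>w :: real ^ 'd. gauss_kernel h w * (L * norm (y - z)))"
      using k(1) by simp
    show "\<bar>gauss_kernel h w * (f (y + w) - f (z + w))\<bar> \<le> gauss_kernel h w * (L * norm (y - z))" for w
      using value_profile_lipschitz[OF f, of "y + w" "z + w"]
      by (auto simp: abs_mult gauss_kernel_nonneg intro!: mult_left_mono)
  qed
  also have "\<dots> = L * norm (y - z)" using k by simp
  finally show "\<bar>gauss_smooth h f y - gauss_smooth h f z\<bar> \<le> L * norm (y - z)" .
  show "0 \<le> gauss_smooth h f y"
    unfolding gauss_smooth_def 
    by (intro integral_nonneg_AE AE_I2 mult_nonneg_nonneg gauss_kernel_nonneg value_profile_nonneg[OF f])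
  have "gauss_smooth h f y \<le> (\<integral>w. gauss_kernel h w \<partial>(lborel :: (real ^ 'd) measure))"
    unfolding gauss_smooth_def
    by (intro integral_mono int k mult_left_le value_profile_le_1[OF f] gauss_kernel_nonneg)
  then show "gauss_smooth h f y \<le> 1" using k by simp
qed

text \<open>
  The exact dynamic programming step over a time \<open>h\<close> when the drift of norm at most \<open>h\<close> has to be chosen
  at the start of the step. The smoothed function depends on the norm only, so the best drift for
  \<open>c = 1\<close> (minimisation) moves the norm from \<open>norm y\<close> to \<open>norm y + h\<close>, and for \<open>c = - 1\<close> (maximisation)
  to \<open>norm y - h\<close> cut off at 0. The unit vector \<open>axis undefined 1\<close> only serves to evaluate a radial
  function at a given norm.
\<close>

definition radial_step :: "real \<Rightarrow> real \<Rightarrow> (real ^ 'd::finite \<Rightarrow> real) \<Rightarrow> real ^ 'd \<Rightarrow> real" where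
  "radial_step c h f y = gauss_smooth h f (max (norm y + c * h) 0 *\<^sub>R axis undefined 1)"

lemma value_profile_radial_step:
  fixes f :: "real ^ 'd::finite \<Rightarrow> real"
  assumes f: "value_profile L f" and h: "0 < h" 
  shows "value_profile L (radial_step c h f)"
proof -
  note g = gauss_smooth_value_profile[OF f h]
  let ?r = "\<lambda>y :: real ^ 'd. max (norm y + c * h) 0"
  have L: "0 \<le> L" using value_profile_lipschitz[OF f, of "axis undefined 1" 0] by auto
  have "\<bar>radial_step c h f y - radial_step c h f z\<bar> \<le> L * norm (y - z)" for y z
  proof -
    have "\<bar>radial_step c h f y - radial_step c h f z\<bar> 
        \<le> L * norm (?r y *\<^sub>R axis undefined 1 - ?r z *\<^sub>R axis undefined 1 :: real ^ 'd)"
      unfolding radial_step_def by (rule value_profile_lipschitz[OF g])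
    also have "\<dots> = L * \<bar>?r y - ?r z\<bar>"
      by (simp flip: scaleR_diff_left)
    also have "\<dots> \<le> L * norm (y - z)"
      using norm_triangle_ineq3[of y z] by (intro mult_left_mono L) auto
    finally show ?thesis .
  qed
  then show ?thesis
    unfolding value_profile_def[of _ "radial_step c h f"] radially_decreasing_def
    by (auto simp: radial_step_def value_profile_nonneg[OF g] value_profile_le_1[OF g] intro!: value_profile_mono[OF g])
qed

text \<open>
  The factor \<open>c\<close> lets one inequality cover both problems: for \<open>c = 1\<close> it is a lower bound on the
  attainable values, and for \<open>c = - 1\<close> an upper bound.
\<close>

lemma radial_step_optimal:
  fixes f :: "real ^ 'd::finite \<Rightarrow> real"
  assumes f: "value_profile L f" and h: "0 < h" and c: "\<bar>c\<bar> = 1" and a: "norm a \<le> h"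
  shows "c * radial_step c h f y \<le> c * gauss_smooth h f (y + a)"
proof (cases "c = 1")
  case True
  show ?thesis
    using norm_triangle_ineq[of y a] a h True unfolding radial_step_def
    by (auto intro!: value_profile_mono[OF gauss_smooth_value_profile[OF f h]])
next
  case False
  then have "c = -1" using c by auto
  then show ?thesis
    using norm_diff_ineq[of y a] a h unfolding radial_step_def
    by (auto intro!: value_profile_mono[OF gauss_smooth_value_profile[OF f h]])
qed

text \<open>
  The drift \<open>c * h\<close> in direction \<open>sgn y\<close> produces exactly the optimal norm unless \<open>y\<close> is within
  distance \<open>h\<close> of the origin, where \<open>- sgn\<close> overshoots the origin and \<open>sgn 0 = 0\<close> wastes the drift.
\<close>

lemma radial_step_near:
  fixes f :: "real ^ 'd::finite \<Rightarrow> real"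
  assumes f: "value_profile L f" and h: "0 < h" and c: "\<bar>c\<bar> = 1"
  shows "\<bar>radial_step c h f y - gauss_smooth h f (y + (c * h) *\<^sub>R sgn y)\<bar> \<le> L * (h * indicator {y. norm y < h} y)"
proof -
  note g = gauss_smooth_value_profile[OF f h]
  let ?r = "max (norm y + c * h) 0" and ?e = "axis undefined 1 :: real ^ 'd"
  let ?s = "norm (y + (c * h) *\<^sub>R sgn y)"
  have L: "0 \<le> L" using value_profile_lipschitz[OF f, of "axis undefined 1" 0] by auto
  have eq: "gauss_smooth h f (y + (c * h) *\<^sub>R sgn y) = gauss_smooth h f (?s *\<^sub>R ?e)"
    by (intro antisym value_profile_mono[OF g]) auto
  have "\<bar>radial_step c h f y - gauss_smooth h f (?s *\<^sub>R ?e)\<bar> \<le> L * norm (?r *\<^sub>R ?e - ?s *\<^sub>R ?e)"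
    unfolding radial_step_def by (rule value_profile_lipschitz[OF g])
  also have "\<dots> = L * \<bar>?r - ?s\<bar>"
    by (simp flip: scaleR_diff_left)
  also have "\<bar>?r - ?s\<bar> \<le> h * indicator {y. norm y < h} y"
  proof (cases "y = 0")
    case True
    have "c = 1 \<or> c = -1" using c by auto
    then show ?thesis using True h by auto
  next
    case False
    have "y + (c * h) *\<^sub>R sgn y = (norm y + c * h) *\<^sub>R sgn y"
      using False by (simp add: scaleR_add_left) (simp add: sgn_div_norm)
    then have s: "?s = \<bar>norm y + c * h\<bar>" using False by (simp add: norm_sgn)
    have "c = 1 \<or> c = -1" using c by auto
    then show ?thesis unfolding s using h by (auto simp: indicator_def)
  qed
  finally show ?thesis using L eq by (simp add: mult_left_mono)
qed

text \<open>
  A Gaussian of variance \<open>h\<close> has density of order \<open>h\<close> to the power \<open>- n / 2\<close>, a ball of radius \<open>h\<close> has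
  volume of order \<open>h ^ n\<close>. This limit is the reason why a controlled Brownian motion does not hit the
  origin at a given time.
\<close>

lemma gauss_ball_bound_tendsto_0:
  "((\<lambda>h. (1 / sqrt (2 * pi * h)) ^ n * (C * h ^ n)) \<longlongrightarrow> 0) (at_right 0)" if "0 < n" for C :: real
proof -
  have "((\<lambda>h. C * (sqrt h / sqrt (2 * pi)) ^ n) \<longlongrightarrow> C * (sqrt 0 / sqrt (2 * pi)) ^ n) (at_right 0)"
    by (intro tendsto_intros) auto
  then have "((\<lambda>h. C * (sqrt h / sqrt (2 * pi)) ^ n) \<longlongrightarrow> 0) (at_right 0)"
    using that by (simp add: zero_power)
  moreover have "eventually (\<lambda>h. C * (sqrt h / sqrt (2 * pi)) ^ n = (1 / sqrt (2 * pi * h)) ^ n * (C * h ^ n)) (at_right 0)"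
    unfolding eventually_at_right_field
  proof (intro exI[of _ 1] conjI allI impI)
    fix h :: real assume h: "0 < h"
    then have "1 / sqrt (2 * pi * h) * h = sqrt h / sqrt (2 * pi)"
      by (simp add: real_sqrt_mult field_simps)
    then have "(1 / sqrt (2 * pi * h)) ^ n * h ^ n = (sqrt h / sqrt (2 * pi)) ^ n"
      by (simp flip: power_mult_distrib)
    then show "C * (sqrt h / sqrt (2 * pi)) ^ n = (1 / sqrt (2 * pi * h)) ^ n * (C * h ^ n)"
      by simp
  qed simp
  ultimately show ?thesis by (rule Lim_transform_eventually)
qed

lemma gauss_smooth_cball_le:
  fixes y :: "real ^ 'd::finite"
  assumes h: "0 < h"
  shows "gauss_smooth h (indicator (cball 0 h)) y
    \<le> (1 / sqrt (2 * pi * h)) ^ CARD('d) * (unit_ball_vol (real CARD('d)) * h ^ CARD('d))"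
proof -
  let ?K = "(1 / sqrt (2 * pi * h)) ^ CARD('d)"
  have ind: "indicator (cball 0 h) (y + z) = (indicator (cball (- y) h) z :: real)" for z
    by (auto simp: indicator_def dist_norm norm_minus_commute algebra_simps)
  have "gauss_smooth h (indicator (cball 0 h)) y
      \<le> (\<integral>z. ?K * indicator (cball (- y) h) z \<partial>lborel)"
    unfolding gauss_smooth_def ind
    using gauss_kernel_le[OF h, where 'd='d] emeasure_lborel_cball_finite[of "- y" h]
    by (intro integral_mono integrable_real_mult_indicator integrable_gauss_kernel h integrable_mult_right)
       (auto intro!: mult_right_mono)
  also have "\<dots> = ?K * measure lborel (cball (- y) h)" by simp
  also have "measure lborel (cball (- y) h) = unit_ball_vol (real CARD('d)) * h ^ CARD('d)"
    using content_cball[of h "- y"] h by (simp add: DIM_cart)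
  finally show ?thesis .
qed

section \<open>Time integrals of controls\<close>

lemma jointly_measurable_compose:
  assumes u: "jointly_measurable M u" and g: "g \<in> borel_measurable N" and g0: "\<And>z. z \<in> space N \<Longrightarrow> 0 \<le> g z"
    and X: "X \<in> measurable N M"
  shows "(\<lambda>z. u (g z) (X z)) \<in> borel_measurable N"
proof -
  have "g \<in> measurable N (restrict_space borel {0..})"
    using g g0 by (intro measurable_restrict_space2) auto
  from measurable_compose[OF measurable_Pair[OF this X] u[unfolded jointly_measurable_def]]
  show ?thesis by simp
qed

text \<open>
  The time interval is half-open so that adjacent intervals are disjoint.
\<close>

definition drift :: "(real \<Rightarrow> 'a \<Rightarrow> real ^ 'd::finite) \<Rightarrow> real \<Rightarrow> real \<Rightarrow> 'a \<Rightarrow> real ^ 'd" where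
  "drift u a b \<omega> = set_lebesgue_integral lborel {a<..b} (\<lambda>s. u s \<omega>)"

lemma drift_self [simp]: "drift u a a \<omega> = 0"
  by (simp add: drift_def set_lebesgue_integral_def)

lemma integrable_indicator_interval:
  shows "integrable lborel (indicator {a..b :: real} :: real \<Rightarrow> real)"
    and "integrable lborel (indicator {a<..b :: real} :: real \<Rightarrow> real)"
proof -
  show Icc: "integrable lborel (indicator {a..b} :: real \<Rightarrow> real)"
    by (intro integrable_real_indicator) (auto simp: emeasure_lborel_Icc_eq)
  show "integrable lborel (indicator {a<..b} :: real \<Rightarrow> real)"
    by (rule Bochner_Integration.integrable_bound[OF Icc]) (auto simp: indicator_def)
qed

context usual_filtered_prob_space
begin

lemma space_F: "0 \<le> t \<Longrightarrow> space (F t) = space M"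
  using subalgebra_F[of t] by (simp add: subalgebra_def)

lemma measurable_F_M: "0 \<le> t \<Longrightarrow> f \<in> measurable (F t) N \<Longrightarrow> f \<in> measurable M N"
  using measurable_from_subalg[OF subalgebra_F] by blast

lemma measurable_F_mono: "0 \<le> s \<Longrightarrow> s \<le> t \<Longrightarrow> f \<in> measurable (F s) N \<Longrightarrow> f \<in> measurable (F t) N"
  using mono_F[of s t] by (auto simp: space_F measurable_def)

lemma borel_measurable_F_AE_cong:
  assumes t: "0 \<le> t" and f: "f \<in> borel_measurable M" and g: "g \<in> borel_measurable (F t)"
    and eq: "AE \<omega> in M. f \<omega> = g \<omega>"
  shows "f \<in> borel_measurable (F t)"
proof -
  obtain N where N: "N \<in> null_sets M" and fg: "\<And>\<omega>. \<omega> \<in> space M - N \<Longrightarrow> f \<omega> = g \<omega>"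
    using eq by (elim AE_E3) auto
  have null_F: "A \<in> sets (F t)" if "A \<in> null_sets M" for A
    using that null_sets_F mono_F[of 0 t] t by auto
  show ?thesis
  proof (rule measurableI)
    fix S :: "'b set" assume S: "S \<in> sets borel"
    have "f -` S \<inter> space M \<inter> N \<in> null_sets M"
      using N f S by (intro null_set_Int1) auto
    moreover have "g -` S \<inter> space M - N \<in> sets (F t)"
      using g S null_F[OF N] t by (metis measurable_sets sets.Diff space_F)
    moreover have "f -` S \<inter> space (F t) = (f -` S \<inter> space M \<inter> N) \<union> (g -` S \<inter> space M - N)"
      using fg t by (auto simp: space_F)
    ultimately show "f -` S \<inter> space (F t) \<in> sets (F t)"
      using null_F by auto
  qed simp
qed

lemma integrable_lborel_M:
  fixes g :: "real \<times> 'a \<Rightarrow> real"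
  assumes [measurable]: "g \<in> borel_measurable (lborel \<Otimes>\<^sub>M M)"
    and le: "\<And>s \<omega>. \<omega> \<in> space M \<Longrightarrow> \<bar>g (s, \<omega>)\<bar> \<le> B * indicator {a..b} s"
  shows "integrable (lborel \<Otimes>\<^sub>M M) g"
proof -
  have "emeasure (lborel \<Otimes>\<^sub>M M) ({a..b} \<times> space M) = emeasure lborel {a..b} * emeasure M (space M)"
    by (intro emeasure_pair_measure_Times) auto
  then have "emeasure (lborel \<Otimes>\<^sub>M M) ({a..b} \<times> space M) < \<infinity>"
    by (simp add: emeasure_space_1 emeasure_lborel_Icc_eq)
  then have "integrable (lborel \<Otimes>\<^sub>M M) (\<lambda>z. B * indicator ({a..b} \<times> space M) z)"
    by (intro integrable_mult_right integrable_real_indicator) auto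
  then show ?thesis
  proof (rule Bochner_Integration.integrable_bound)
    show "AE z in (lborel :: real measure) \<Otimes>\<^sub>M M. norm (g z) \<le> norm (B * indicator ({a..b} \<times> space M) z)"
    proof (rule AE_I2)
      fix z assume "z \<in> space ((lborel :: real measure) \<Otimes>\<^sub>M M)"
      then obtain s \<omega> where z: "z = (s, \<omega>)" and \<omega>: "\<omega> \<in> space M" by (auto simp: space_pair_measure)
      have "\<bar>g (s, \<omega>)\<bar> \<le> \<bar>B * indicator {a..b} s\<bar>"
        using le[OF \<omega>, of s] by linarith
      then show "norm (g z) \<le> norm (B * indicator ({a..b} \<times> space M) z)"
        using \<omega> by (simp add: z indicator_times)
    qed
  qed measurable
qed

text \<open>
  A measurable adapted process need not be progressively measurable, so adaptedness of its time
  integral \<open>A\<close> needs an argument: \<open>A\<close> equals its conditional expectation given \<open>F t\<close> almost surely, and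
  \<open>F t\<close> contains the null sets. For the equality, integrate against the indicator of an event \<open>C\<close>:
  inside the time integral every \<open>u s\<close> is \<open>F t\<close>-measurable, so the indicator may be replaced by its
  conditional expectation \<open>p\<close>, and by Fubini the same replacement is allowed for \<open>A\<close>.
\<close>

lemma adapted_time_integral_real:
  fixes u :: "real \<Rightarrow> 'a \<Rightarrow> real"
  assumes t: "0 \<le> t" and jm: "jointly_measurable M u"
    and ad: "adapted F u" and bd: "\<And>s \<omega>. 0 \<le> s \<Longrightarrow> \<omega> \<in> space M \<Longrightarrow> \<bar>u s \<omega>\<bar> \<le> 1"
    and a: "0 \<le> a" 
  shows "(\<lambda>\<omega>. set_lebesgue_integral lborel {a<..t} (\<lambda>s. u s \<omega>)) \<in> borel_measurable (F t)"
proof -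
  interpret finite_measure_subalgebra M "F t"
    by unfold_locales (rule subalgebra_F[OF t])
  interpret TM: pair_sigma_finite lborel M ..
  define U where "U s \<omega> = indicator {a<..t} s * u (max s 0) \<omega>" for s \<omega>
  have [measurable]: "(\<lambda>(s, \<omega>). U s \<omega>) \<in> borel_measurable (lborel \<Otimes>\<^sub>M M)"
    using jointly_measurable_compose[OF jm, of "\<lambda>z. max (fst z) 0" "lborel \<Otimes>\<^sub>M M" snd]
    by (simp add: U_def split_beta')
  have U_le: "\<bar>U s \<omega>\<bar> \<le> indicator {a..t} s" if "\<omega> \<in> space M" for s \<omega>
    using bd[of "max s 0" \<omega>] that by (auto simp: U_def indicator_def)
  define A where "A \<omega> = (\<integral>s. U s \<omega> \<partial>lborel)" for \<omega>
  have A_eq: "set_lebesgue_integral lborel {a<..t} (\<lambda>s. u s \<omega>) = A \<omega>" for \<omega>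
    unfolding set_lebesgue_integral_def A_def U_def using a
    by (intro Bochner_Integration.integral_cong) (auto simp: indicator_def max_def)
  have [measurable]: "A \<in> borel_measurable M"
    unfolding A_def by measurable
  have U_int: "integrable lborel (\<lambda>s. U s \<omega>)" if "\<omega> \<in> space M" for \<omega>
    by (rule Bochner_Integration.integrable_bound[OF integrable_indicator_interval(1)[of a t]])
       (use that U_le[OF that] in auto)
  have A_le: "\<bar>A \<omega>\<bar> \<le> measure lborel {a..t}" if "\<omega> \<in> space M" for \<omega>
  proof -
    have "\<bar>A \<omega>\<bar> \<le> (\<integral>s. indicator {a..t} s \<partial>lborel)"
      unfolding A_def by (rule integral_abs_bound_integral[OF U_int[OF that] integrable_indicator_interval(1)]) (use U_le[OF that] in auto)
    then show ?thesis by simp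
  qed
  have fub: "(\<integral>\<omega>. A \<omega> * Z \<omega> \<partial>M) = (\<integral>s. (\<integral>\<omega>. U s \<omega> * Z \<omega> \<partial>M) \<partial>lborel)"
    if [measurable]: "Z \<in> borel_measurable M" and Z: "\<And>\<omega>. \<bar>Z \<omega>\<bar> \<le> 1" for Z
  proof -
    have "integrable (lborel \<Otimes>\<^sub>M M) (\<lambda>(s, \<omega>). U s \<omega> * Z \<omega>)"
    proof (rule integrable_lborel_M[where B=1 and a=a and b=t])
      show "\<bar>case (s, \<omega>) of (s, \<omega>) \<Rightarrow> U s \<omega> * Z \<omega>\<bar> \<le> 1 * indicator {a..t} s" if "\<omega> \<in> space M" for s \<omega>
        using mult_mono[OF U_le[OF that, of s] Z[of \<omega>]] by (simp add: abs_mult)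
    qed measurable
    from TM.Fubini_integral[OF this] show ?thesis
      by (simp add: A_def)
  qed
  define B where "B = real_cond_exp M (F t) A"
  have A_int: "integrable M A"
    by (rule integrable_const_bound[where B="measure lborel {a..t}"]) (use A_le in auto)
  have B_meas [measurable]: "B \<in> borel_measurable (F t)" and [measurable]: "B \<in> borel_measurable M"
    by (auto simp: B_def)
  have B_int: "integrable M B"
    unfolding B_def by (rule real_cond_exp_int(1)[OF A_int])
  have "AE \<omega> in M. A \<omega> = B \<omega>"
  proof (rule density_unique_real[OF A_int B_int])
    fix C assume C [measurable]: "C \<in> sets M"
    let ?I = "indicator C :: 'a \<Rightarrow> real"
    define q where "q = real_cond_exp M (F t) ?I"
    \<comment> \<open>Clipping only changes the conditional expectation on a null set and makes it bounded everywhere.\<close>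
    define p where "p \<omega> = max 0 (min 1 (q \<omega>))" for \<omega>
    have I_int: "integrable M ?I"
      by (rule integrable_const_bound[where B=1]) (auto simp: indicator_def)
    have [measurable]: "q \<in> borel_measurable (F t)" "q \<in> borel_measurable M" by (auto simp: q_def)
    have p_meas: "p \<in> borel_measurable (F t)" and [measurable]: "p \<in> borel_measurable M"
      unfolding p_def by measurable
    have "AE \<omega> in M. 0 \<le> q \<omega>" "AE \<omega> in M. q \<omega> \<le> 1"
      unfolding q_def by (rule real_cond_exp_ge_c[OF I_int] real_cond_exp_le_c[OF I_int], simp)+
    then have qp: "AE \<omega> in M. q \<omega> = p \<omega>" by eventually_elim (simp add: p_def)
    have p_le: "\<bar>p \<omega>\<bar> \<le> 1" for \<omega> by (simp add: p_def)
    have cond: "(\<integral>\<omega>. g \<omega> * ?I \<omega> \<partial>M) = (\<integral>\<omega>. g \<omega> * p \<omega> \<partial>M)"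
      if g: "g \<in> borel_measurable (F t)" and int: "integrable M g" for g
    proof -
      have gM [measurable]: "g \<in> borel_measurable M" using g by (rule measurable_F_M[OF t])
      have "(\<integral>\<omega>. g \<omega> * ?I \<omega> \<partial>M) = (\<integral>\<omega>. g \<omega> * q \<omega> \<partial>M)"
        unfolding q_def
        by (rule real_cond_exp_intg(2)[OF _ g, symmetric]) (auto intro!: integrable_real_mult_indicator int)
      also have "\<dots> = (\<integral>\<omega>. g \<omega> * p \<omega> \<partial>M)"
        by (rule integral_cong_AE) (use qp in \<open>auto elim: eventually_mono\<close>)
      finally show ?thesis .
    qed
    have U_meas: "U s \<in> borel_measurable (F t)" for s
    proof (cases "s \<in> {a<..t}")
      case True
      then have "u s \<in> borel_measurable (F t)"
        using ad a by (intro measurable_F_mono[of s t]) (auto simp: adapted_def)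
      then show ?thesis using True a by (simp add: U_def[abs_def] max_def)
    next
      case False
      then have "U s = (\<lambda>_. 0)" by (auto simp: U_def)
      then show ?thesis by simp
    qed
    have U_int': "integrable M (U s)" for s
    proof (rule integrable_const_bound[where B=1])
      show "AE \<omega> in M. norm (U s \<omega>) \<le> 1"
        using order_trans[OF U_le indicator_le_1] by auto
    qed (rule measurable_F_M[OF t U_meas])
    have "(\<integral>\<omega>. A \<omega> * ?I \<omega> \<partial>M) = (\<integral>s. (\<integral>\<omega>. U s \<omega> * ?I \<omega> \<partial>M) \<partial>lborel)"
      by (rule fub) (auto simp: indicator_def)
    also have "\<dots> = (\<integral>s. (\<integral>\<omega>. U s \<omega> * p \<omega> \<partial>M) \<partial>lborel)"
      by (simp add: cond U_meas U_int')
    also have "\<dots> = (\<integral>\<omega>. A \<omega> * p \<omega> \<partial>M)"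
      by (rule fub[symmetric]) (auto simp: p_le)
    also have "\<dots> = (\<integral>\<omega>. p \<omega> * A \<omega> \<partial>M)" by (simp add: mult.commute)
    also have "\<dots> = (\<integral>\<omega>. p \<omega> * B \<omega> \<partial>M)"
      unfolding B_def
      by (rule real_cond_exp_intg(2)[OF _ p_meas, symmetric])
         (auto intro!: Bochner_Integration.integrable_bound[OF A_int] AE_I2 mult_left_le_one_le p_le simp: abs_mult)
    also have "\<dots> = (\<integral>\<omega>. B \<omega> * p \<omega> \<partial>M)" by (simp add: mult.commute)
    also have "\<dots> = (\<integral>\<omega>. B \<omega> * ?I \<omega> \<partial>M)"
      by (rule cond[symmetric, OF B_meas B_int])
    finally show "set_lebesgue_integral M C A = set_lebesgue_integral M C B"
      by (simp add: set_lebesgue_integral_def mult.commute)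
  qed
  then show ?thesis
    unfolding A_eq using B_meas t by (intro borel_measurable_F_AE_cong[of t A B]) auto
qed

lemma admissible_controlD:
  assumes "u \<in> admissible_controls M F"
  shows admissible_jointly_measurable: "jointly_measurable M u" and admissible_adapted: "adapted F u"
    and admissible_norm_le: "\<And>t \<omega>. 0 \<le> t \<Longrightarrow> \<omega> \<in> space M \<Longrightarrow> norm (u t \<omega>) \<le> 1"
  using assms by (auto simp: admissible_controls_def)

lemma set_integrable_admissible:
  fixes u :: "real \<Rightarrow> 'a \<Rightarrow> real ^ 'd::finite"
  assumes u: "u \<in> admissible_controls M F" and a: "0 \<le> a" and \<omega>: "\<omega> \<in> space M" 
    and S: "S \<in> sets borel" "S \<subseteq> {a..b}"
  shows "set_integrable lborel S (\<lambda>s. u s \<omega>)"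
  unfolding set_integrable_def
proof (rule Bochner_Integration.integrable_bound[where f="indicator {a..b} :: real \<Rightarrow> real"])
  have "(\<lambda>s. u (max s 0) \<omega>) \<in> borel_measurable lborel"
    using \<omega> by (intro jointly_measurable_compose[OF admissible_jointly_measurable[OF u]]) auto
  then have "(\<lambda>s. indicator S s *\<^sub>R u (max s 0) \<omega>) \<in> borel_measurable lborel"
    using S by (intro borel_measurable_scaleR borel_measurable_indicator) auto
  also have "(\<lambda>s. indicator S s *\<^sub>R u (max s 0) \<omega>) = (\<lambda>s. indicator S s *\<^sub>R u s \<omega>)"
  proof
    fix s
    have "max s 0 = s" if "s \<in> S" using that S a by force
    then show "indicator S s *\<^sub>R u (max s 0) \<omega> = indicator S s *\<^sub>R u s \<omega>" by (auto simp: indicator_def)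
  qed
  finally show "(\<lambda>s. indicator S s *\<^sub>R u s \<omega>) \<in> borel_measurable lborel" .
  show "AE s in lborel. norm (indicator S s *\<^sub>R u s \<omega>) \<le> norm (indicator {a..b} s :: real)"
    using S a admissible_norm_le[OF u _ \<omega>] by (intro AE_I2) (force simp: indicator_def)
qed (rule integrable_indicator_interval)

lemma set_integrable_admissible_Ioc:
  fixes u :: "real \<Rightarrow> 'a \<Rightarrow> real ^ 'd::finite"
  assumes "u \<in> admissible_controls M F" "0 \<le> a" "\<omega> \<in> space M"
  shows "integrable lborel (\<lambda>s. indicator {a<..b} s *\<^sub>R u s \<omega>)"
  using set_integrable_admissible[OF assms, of "{a<..b}" b] 
  by (auto simp: set_integrable_def greaterThanAtMost_subseteq_atLeastAtMost_iff)

lemma drift_add: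
  fixes u :: "real \<Rightarrow> 'a \<Rightarrow> real ^ 'd::finite"
  assumes u: "u \<in> admissible_controls M F" and "0 \<le> a" "a \<le> b" "b \<le> c" and \<omega>: "\<omega> \<in> space M"
  shows "drift u a c \<omega> = drift u a b \<omega> + drift u b c \<omega>"
proof -
  have "{a<..c} = {a<..b} \<union> {b<..c}" using assms by auto
  then show ?thesis unfolding drift_def
    using assms by (simp del: ivl_disj_un)
      (intro set_integral_Un set_integrable_admissible[OF u, of a _ _ c], auto)
qed

lemma norm_drift_le:
  fixes u :: "real \<Rightarrow> 'a \<Rightarrow> real ^ 'd::finite"
  assumes u: "u \<in> admissible_controls M F" and a: "0 \<le> a" "a \<le> b" and \<omega>: "\<omega> \<in> space M"
  shows "norm (drift u a b \<omega>) \<le> b - a"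
proof -
  have "norm (drift u a b \<omega>) \<le> (\<integral>s. indicator {a<..b} s \<partial>(lborel :: real measure))"
    unfolding drift_def set_lebesgue_integral_def
  proof (rule Bochner_Integration.integral_norm_bound_integral)
    show "integrable lborel (\<lambda>s. indicator {a<..b} s *\<^sub>R u s \<omega>)"
      by (rule set_integrable_admissible_Ioc[OF u a(1) \<omega>])
    show "integrable lborel (indicator {a<..b} :: real \<Rightarrow> real)"
      by (rule integrable_indicator_interval)
    show "norm (indicator {a<..b} s *\<^sub>R u s \<omega>) \<le> indicator {a<..b} s" for s
      using a admissible_norm_le[OF u _ \<omega>, of s] by (auto simp: indicator_def)
  qed
  then show ?thesis using a by simp
qed

lemma drift_measurable:
  fixes u :: "real \<Rightarrow> 'a \<Rightarrow> real ^ 'd::finite"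
  assumes u: "u \<in> admissible_controls M F" and a: "0 \<le> a" "a \<le> b"
  shows "drift u a b \<in> borel_measurable (F b)"
proof (subst borel_measurable_euclidean_space, intro ballI)
  fix i :: "real ^ 'd" assume i: "i \<in> Basis"
  note jm = admissible_jointly_measurable[OF u, unfolded jointly_measurable_def]
  have "(\<lambda>\<omega>. set_lebesgue_integral lborel {a<..b} (\<lambda>s. u s \<omega> \<bullet> i)) \<in> borel_measurable (F b)"
  proof (rule adapted_time_integral_real)
    show "jointly_measurable M (\<lambda>s \<omega>. u s \<omega> \<bullet> i)"
      using borel_measurable_inner[OF jm borel_measurable_const[of i]]
      by (simp add: jointly_measurable_def split_beta')
    show "adapted F (\<lambda>s \<omega>. u s \<omega> \<bullet> i)"
      using admissible_adapted[OF u] by (auto simp: adapted_def)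
    show "\<bar>u s \<omega> \<bullet> i\<bar> \<le> 1" if "0 \<le> s" "\<omega> \<in> space M" for s \<omega>
      using admissible_norm_le[OF u that] Basis_le_norm[OF i, of "u s \<omega>"] by linarith
  qed (use a in auto)
  moreover have "drift u a b \<omega> \<bullet> i = set_lebesgue_integral lborel {a<..b} (\<lambda>s. u s \<omega> \<bullet> i)"
    if "\<omega> \<in> space (F b)" for \<omega>
    using set_integrable_admissible_Ioc[OF u a(1), of \<omega> b] that a
    by (simp add: drift_def set_lebesgue_integral_def space_F flip: integral_inner_left)
  ultimately show "(\<lambda>\<omega>. drift u a b \<omega> \<bullet> i) \<in> borel_measurable (F b)"
    by (simp cong: measurable_cong)
qed

lemma set_integral_eq_drift:
  fixes u :: "real \<Rightarrow> 'a \<Rightarrow> real ^ 'd::finite"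
  assumes u: "u \<in> admissible_controls M F" and a: "0 \<le> a" and \<omega>: "\<omega> \<in> space M"
  shows "set_lebesgue_integral lborel {a..b} (\<lambda>s. u s \<omega>) = drift u a b \<omega>"
  unfolding drift_def set_lebesgue_integral_def
proof (rule integral_cong_AE)
  show "AE s in lborel. indicator {a..b} s *\<^sub>R u s \<omega> = indicator {a<..b} s *\<^sub>R u s \<omega>"
    using AE_lborel_singleton[of a] by eventually_elim (auto simp: indicator_def)
qed (use set_integrable_admissible_Ioc[OF u a \<omega>, of b]
  set_integrable_admissible[OF u a \<omega>, of "{a..b}" b] in \<open>auto simp: set_integrable_def\<close>)

lemma controlled_process_eq:
  fixes u :: "real \<Rightarrow> 'a \<Rightarrow> real ^ 'd::finite"
  assumes "u \<in> admissible_controls M F" "\<omega> \<in> space M"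
  shows "controlled_process W x u t \<omega> = x + drift u 0 t \<omega> + W t \<omega>"
  using assms by (simp add: controlled_process_def set_integral_eq_drift)

end

section \<open>Controlled Brownian motion\<close>

context brownian_motion
begin

lemma W_measurable: "0 \<le> t \<Longrightarrow> W t \<in> borel_measurable (F t)"
  using adapted_W by (simp add: adapted_def)

lemma W_measurable_M: "0 \<le> t \<Longrightarrow> W t \<in> borel_measurable M"
  using W_measurable measurable_F_M by blast

text \<open>
  The increment is independent of \<open>A\<close>, so conditioning on \<open>F s\<close> amounts to Gaussian smoothing.
\<close>

lemma expectation_increment:
  fixes f :: "real ^ 'd \<Rightarrow> real"
  assumes s: "0 \<le> s" "s < t" and A: "A \<in> borel_measurable (F s)"
    and [measurable]: "f \<in> borel_measurable borel" and f: "\<And>y. \<bar>f y\<bar> \<le> B"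
  shows "expectation (\<lambda>\<omega>. f (A \<omega> + (W t \<omega> - W s \<omega>))) = expectation (\<lambda>\<omega>. gauss_smooth (t - s) f (A \<omega>))"
proof -
  let ?D = "\<lambda>\<omega>. W t \<omega> - W s \<omega>"
  have [measurable]: "A \<in> borel_measurable M" using A s measurable_F_M by blast
  have [measurable]: "W t \<in> borel_measurable M" "W s \<in> borel_measurable M"
    using s by (auto intro: W_measurable_M)
  have D_sets: "sigma_sets (space M) {?D -` S \<inter> space M | S. S \<in> sets borel} = {?D -` S \<inter> space M | S. S \<in> sets borel}"
    using sets_vimage_algebra[of "space M" ?D "borel :: (real ^ 'd) measure"]
      sets_vimage_algebra2[of ?D "space M" "borel :: (real ^ 'd) measure"] by auto
  have A_sets: "sigma_sets (space M) {A -` S \<inter> space M | S. S \<in> sets borel} \<subseteq> sets (F s)"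
    using A s by (intro sets.sigma_sets_subset[of _ "F s", unfolded space_F[OF s(1)]])
      (auto simp flip: space_F[OF s(1)])
  have indep_mono: "indep_set G H" if "indep_set G' H" "G \<subseteq> G'" for G G' H
    using that unfolding indep_sets2_eq by blast
  have "indep_var borel A borel ?D"
    unfolding indep_var_eq D_sets
    by (intro conjI indep_mono[OF indep_increments_W[OF s] A_sets]) measurable
  then have pair: "distr M borel A \<Otimes>\<^sub>M distr M borel ?D = distr M (borel \<Otimes>\<^sub>M borel) (\<lambda>\<omega>. (A \<omega>, ?D \<omega>))"
    by (simp add: indep_var_distribution_eq)
  have D_distr: "distr M borel ?D = density lborel (\<lambda>z. ennreal (gauss_kernel (t - s) z))"
    using normal_increments_W[OF s] by (simp add: distributed_def gauss_kernel_def cong: distr_cong)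
  interpret A: prob_space "distr M borel A" by (rule prob_space_distr) auto
  interpret D: prob_space "distr M borel ?D" by (rule prob_space_distr) auto
  interpret P: pair_prob_space "distr M borel A" "distr M borel ?D" ..
  have "expectation (\<lambda>\<omega>. f (A \<omega> + ?D \<omega>))
      = (\<integral>z. f (fst z + snd z) \<partial>(distr M borel A \<Otimes>\<^sub>M distr M borel ?D))"
    unfolding pair by (subst integral_distr) auto
  also have "\<dots> = (\<integral>a. (\<integral>z. f (a + z) \<partial>distr M borel ?D) \<partial>distr M borel A)"
  proof -
    have "integrable (distr M borel A \<Otimes>\<^sub>M distr M borel ?D) (\<lambda>(a, z). f (a + z))"
      by (rule P.integrable_const_bound[where B=B]) (use f in auto)
    from P.integral_fst'[OF this] show ?thesis by (simp add: split_beta')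
  qed
  also have "\<dots> = (\<integral>a. gauss_smooth (t - s) f a \<partial>distr M borel A)"
    unfolding D_distr gauss_smooth_def
    by (simp add: integral_density gauss_kernel_nonneg)
  also have "\<dots> = expectation (\<lambda>\<omega>. gauss_smooth (t - s) f (A \<omega>))"
    by (rule integral_distr) (auto simp: gauss_smooth_def[abs_def])
  finally show ?thesis .
qed

lemma controlled_process_measurable:
  assumes u: "u \<in> admissible_controls M F" and t: "0 \<le> t"
  shows "controlled_process W x u t \<in> borel_measurable (F t)"
proof -
  have "(\<lambda>\<omega>. x + drift u 0 t \<omega> + W t \<omega>) \<in> borel_measurable (F t)"
    using drift_measurable[OF u _ t] W_measurable[OF t] by measurable
  moreover have "controlled_process W x u t \<omega> = x + drift u 0 t \<omega> + W t \<omega>" if "\<omega> \<in> space (F t)" for \<omega>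
    using that u t by (simp add: controlled_process_eq space_F)
  ultimately show ?thesis by (simp cong: measurable_cong)
qed

lemma controlled_process_step:
  assumes u: "u \<in> admissible_controls M F" and "0 \<le> s" "s \<le> t" and \<omega>: "\<omega> \<in> space M"
  shows "controlled_process W x u t \<omega>
    = controlled_process W x u s \<omega> + drift u s t \<omega> + (W t \<omega> - W s \<omega>)"
  using assms drift_add[OF u, of 0 s t \<omega>] by (simp add: controlled_process_eq[OF u \<omega>])

lemma controlled_process_start:
  assumes u: "u \<in> admissible_controls M F"
  shows "AE \<omega> in M. controlled_process W x u 0 \<omega> = x"
  using start_W by (rule AE_mp, intro AE_I2 impI) (use u in \<open>simp add: controlled_process_eq\<close>)

text \<open>
  If the process is at the origin at time \<open>t\<close>, then its state at \<open>t - h\<close> plus the last increment of \<open>W\<close>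
  lies in the ball of radius \<open>h\<close>, because the drift moves it by at most \<open>h\<close>. Given the past, this has
  probability of order \<open>h\<close> to the power \<open>d / 2\<close>.
\<close>

lemma controlled_process_nonzero:
  assumes u: "u \<in> admissible_controls M F" and t: "0 < t"
  shows "AE \<omega> in M. controlled_process W x u t \<omega> \<noteq> 0"
proof -
  let ?X = "controlled_process W x u"
  let ?K = "\<lambda>h. (1 / sqrt (2 * pi * h)) ^ CARD('d) * (unit_ball_vol (real CARD('d)) * h ^ CARD('d))"
  have X_M: "?X r \<in> borel_measurable M" if "0 \<le> r" for r
    using controlled_process_measurable[OF u that] that by (rule measurable_F_M[rotated])
  have [measurable]: "?X t \<in> borel_measurable M" using X_M t by simp
  have "prob {\<omega> \<in> space M. ?X t \<omega> = 0} \<le> ?K h" if h: "0 < h" "h < t" for h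
  proof -
    have [measurable]: "?X (t - h) \<in> borel_measurable M" using X_M h by simp
    have [measurable]: "W t \<in> borel_measurable M" "W (t - h) \<in> borel_measurable M"
      using h t by (auto intro: W_measurable_M)
    let ?Z = "\<lambda>\<omega>. ?X (t - h) \<omega> + (W t \<omega> - W (t - h) \<omega>)"
    have "prob {\<omega> \<in> space M. ?X t \<omega> = 0} \<le> prob {\<omega> \<in> space M. norm (?Z \<omega>) \<le> h}"
    proof (rule finite_measure_mono)
      show "{\<omega> \<in> space M. ?X t \<omega> = 0} \<subseteq> {\<omega> \<in> space M. norm (?Z \<omega>) \<le> h}"
      proof safe
        fix \<omega> assume \<omega>: "\<omega> \<in> space M" and "?X t \<omega> = 0"
        then have "?Z \<omega> = - drift u (t - h) t \<omega>"
          using controlled_process_step[OF u _ _ \<omega>, of "t - h" t x] h by (simp add: algebra_simps eq_neg_iff_add_eq_0)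
        then show "norm (?Z \<omega>) \<le> h"
          using norm_drift_le[OF u _ _ \<omega>, of "t - h" t] h by simp
      qed
    qed measurable
    also have "\<dots> = expectation (\<lambda>\<omega>. indicator {\<omega> \<in> space M. norm (?Z \<omega>) \<le> h} \<omega>)"
      by (simp add: Int_def conj_commute)
    also have "\<dots> = expectation (\<lambda>\<omega>. indicator (cball 0 h) (?Z \<omega>))"
      by (rule Bochner_Integration.integral_cong) (auto simp: indicator_def)
    also have "\<dots> = expectation (\<lambda>\<omega>. gauss_smooth (t - (t - h)) (indicator (cball 0 h)) (?X (t - h) \<omega>))"
      using h controlled_process_measurable[OF u, of "t - h" x]
      by (intro expectation_increment[where B=1]) (auto simp: indicator_def)
    also have "\<dots> \<le> ?K h"
    proof -
      have "expectation (\<lambda>\<omega>. gauss_smooth h (indicator (cball 0 h)) (?X (t - h) \<omega>)) \<le> expectation (\<lambda>\<omega>. ?K h)"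
      proof (rule integral_mono')
        show "0 \<le> ?K h" using h by (intro mult_nonneg_nonneg zero_le_power) auto
      qed (use gauss_smooth_cball_le[OF h(1)] in auto)
      then show ?thesis by (simp add: prob_space)
    qed
    finally show ?thesis .
  qed
  then have "eventually (\<lambda>h. prob {\<omega> \<in> space M. ?X t \<omega> = 0} \<le> ?K h) (at_right 0)"
    using t by (auto simp: eventually_at_right_field)
  then have "prob {\<omega> \<in> space M. ?X t \<omega> = 0} \<le> 0"
    by (rule tendsto_lowerbound[OF gauss_ball_bound_tendsto_0[OF zero_less_card_finite]]) auto
  then have "prob {\<omega> \<in> space M. ?X t \<omega> = 0} = 0" by (simp add: measure_le_0_iff)
  then show ?thesis
    by (subst (asm) prob_eq_0) (auto elim: eventually_mono)
qed

lemma value_profile_iterate: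
  "value_profile L f \<Longrightarrow> 0 < h \<Longrightarrow> value_profile L ((radial_step c h ^^ k) f)"
  by (induction k) (auto intro: value_profile_radial_step)

lemma integrable_value_profile:
  fixes f :: "real ^ 'd \<Rightarrow> real"
  assumes f: "value_profile L f" and [measurable]: "X \<in> borel_measurable M"
  shows "integrable M (\<lambda>\<omega>. f (X \<omega>))"
proof -
  have [measurable]: "f \<in> borel_measurable borel" by (rule borel_measurable_value_profile[OF f])
  show ?thesis
    by (rule integrable_const_bound[where B=1]) (use value_profile_abs_le_1[OF f] in auto)
qed

lemma expectation_value_profile_step:
  fixes f :: "real ^ 'd \<Rightarrow> real"
  assumes f: "value_profile L f" and "0 \<le> s" "s < t" "A \<in> borel_measurable (F s)"
  shows "expectation (\<lambda>\<omega>. gauss_smooth (t - s) f (A \<omega>)) = expectation (\<lambda>\<omega>. f (A \<omega> + (W t \<omega> - W s \<omega>)))"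
  using assms borel_measurable_value_profile[OF f] value_profile_abs_le_1[OF f]
  by (intro expectation_increment[symmetric]) auto

lemma expectation_value_profile_diff_le:
  fixes f :: "real ^ 'd \<Rightarrow> real"
  assumes f: "value_profile L f" and X: "X \<in> borel_measurable M" and Y: "Y \<in> borel_measurable M"
    and B: "integrable M B" and le: "AE \<omega> in M. norm (X \<omega> - Y \<omega>) \<le> B \<omega>"
  shows "\<bar>expectation (\<lambda>\<omega>. f (X \<omega>)) - expectation (\<lambda>\<omega>. f (Y \<omega>))\<bar> \<le> L * expectation B"
proof -
  note int = integrable_value_profile[OF f X] integrable_value_profile[OF f Y]
  have L: "0 \<le> L" using value_profile_lipschitz[OF f, of "axis undefined 1" 0] by auto
  have "\<bar>expectation (\<lambda>\<omega>. f (X \<omega>) - f (Y \<omega>))\<bar> \<le> expectation (\<lambda>\<omega>. \<bar>f (X \<omega>) - f (Y \<omega>)\<bar>)"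
    by (rule integral_abs_bound)
  also have "\<dots> \<le> expectation (\<lambda>\<omega>. L * B \<omega>)"
  proof (rule integral_mono_AE)
    show "AE \<omega> in M. \<bar>f (X \<omega>) - f (Y \<omega>)\<bar> \<le> L * B \<omega>"
      using le by eventually_elim (rule order_trans[OF value_profile_lipschitz[OF f] mult_left_mono[OF _ L]])
  qed (use int B in auto)
  finally show ?thesis using int by simp
qed

text \<open>
  Inside a time step a control may react to the noise of that step, which the discrete dynamic
  programming step does not permit. The remedy is to delay the drift by one step: the process \<open>Z\<close>
  below receives on the step from \<open>t k\<close> to \<open>t (Suc k)\<close> the drift that the control accumulated on the
  previous step, which is known at time \<open>t k\<close>. At the end \<open>Z\<close> lacks only the drift of the last step,
  whose norm is at most \<open>h\<close>.
\<close>

lemma radial_value_bounds_controlled: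
  fixes f :: "real ^ 'd \<Rightarrow> real"
  assumes f: "value_profile L f" and h: "0 < h" and c: "\<bar>c\<bar> = 1"
    and u: "u \<in> admissible_controls M F"
  shows "c * (radial_step c h ^^ n) f x
    \<le> c * expectation (\<lambda>\<omega>. f (controlled_process W x u (real n * h) \<omega>)) + L * h"
proof -
  let ?X = "controlled_process W x u"
  define t where "t k = real k * h" for k
  have t: "0 \<le> t k" "t k < t (Suc k)" "t (Suc k) - t k = h" "t (k - 1) \<le> t k" for k
    using h by (auto simp: t_def algebra_simps intro!: mult_right_mono)
  \<comment> \<open>For \<open>k = 0\<close> the truncated \<open>k - 1\<close> makes the subtracted drift vanish.\<close>
  define Z where "Z k \<omega> = ?X (t k) \<omega> - drift u (t (k - 1)) (t k) \<omega>" for k \<omega>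
  have Z_F: "Z k \<in> borel_measurable (F (t k))" for k
    unfolding Z_def[abs_def]
    by (intro borel_measurable_diff controlled_process_measurable drift_measurable u t)
  have Z_M: "Z k \<in> borel_measurable M" for k by (rule measurable_F_M[OF t(1) Z_F])
  have X_M: "?X (t k) \<in> borel_measurable M" for k
    by (rule measurable_F_M[OF t(1) controlled_process_measurable[OF u t(1)]])
  let ?V = "\<lambda>k. (radial_step c h ^^ k) f"
  have V: "value_profile L (?V k)" for k by (rule value_profile_iterate[OF f h])
  have "c * ?V n x \<le> c * expectation (\<lambda>\<omega>. ?V (n - k) (Z k \<omega>))" if "k \<le> n" for k
    using that
  proof (induction k)
    case 0
    have "AE \<omega> in M. Z 0 \<omega> = x"
      using controlled_process_start[OF u, of x] by (auto simp: Z_def t_def)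
    then have "expectation (\<lambda>\<omega>. ?V n (Z 0 \<omega>)) = expectation (\<lambda>_. ?V n x)"
      using integrable_value_profile[OF V Z_M] by (intro integral_cong_AE) auto
    then show ?case by (simp add: prob_space)
  next
    case (Suc k)
    define m where "m = n - Suc k"
    have m: "n - k = Suc m" using Suc by (simp add: m_def)
    have [measurable]: "Z (Suc k) \<in> borel_measurable M" "Z k \<in> borel_measurable M" "?X (t k) \<in> borel_measurable M"
      using Z_M X_M by auto
    have "c * ?V n x \<le> c * expectation (\<lambda>\<omega>. ?V (Suc m) (Z k \<omega>))"
      using Suc m by simp
    also have "\<dots> = expectation (\<lambda>\<omega>. c * radial_step c h (?V m) (Z k \<omega>))"
      by simp
    also have "\<dots> \<le> expectation (\<lambda>\<omega>. c * gauss_smooth h (?V m) (?X (t k) \<omega>))"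
    proof (rule integral_mono)
      show "integrable M (\<lambda>\<omega>. c * radial_step c h (?V m) (Z k \<omega>))"
        by (intro integrable_mult_right integrable_value_profile[OF value_profile_radial_step[OF V h]]) measurable
      show "integrable M (\<lambda>\<omega>. c * gauss_smooth h (?V m) (?X (t k) \<omega>))"
        by (intro integrable_mult_right integrable_value_profile[OF gauss_smooth_value_profile[OF V h]]) measurable
      fix \<omega> assume \<omega>: "\<omega> \<in> space M"
      have "norm (drift u (t (k - 1)) (t k) \<omega>) \<le> t k - t (k - 1)"
        by (rule norm_drift_le[OF u t(1,4) \<omega>])
      also have "\<dots> \<le> h" using h by (cases k) (auto simp: t_def algebra_simps)
      finally show "c * radial_step c h (?V m) (Z k \<omega>) \<le> c * gauss_smooth h (?V m) (?X (t k) \<omega>)"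
        using radial_step_optimal[OF V h c, of "drift u (t (k - 1)) (t k) \<omega>" m "Z k \<omega>"] by (simp add: Z_def)
    qed
    also have "\<dots> = c * expectation (\<lambda>\<omega>. ?V m (?X (t k) \<omega> + (W (t (Suc k)) \<omega> - W (t k) \<omega>)))"
      using expectation_value_profile_step[OF V t(1,2) controlled_process_measurable[OF u t(1)], of k m x]
      by (simp add: t(3))
    also have "\<dots> = c * expectation (\<lambda>\<omega>. ?V m (Z (Suc k) \<omega>))"
    proof -
      have "Z (Suc k) \<omega> = ?X (t k) \<omega> + (W (t (Suc k)) \<omega> - W (t k) \<omega>)" if "\<omega> \<in> space M" for \<omega>
        using controlled_process_step[OF u t(1)[of k] less_imp_le[OF t(2)] that, of x] by (simp add: Z_def)
      then show ?thesis by (simp cong: Bochner_Integration.integral_cong)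
    qed
    finally show ?case by (simp add: m_def)
  qed
  from this[of n] have "c * ?V n x \<le> c * expectation (\<lambda>\<omega>. f (Z n \<omega>))" by simp
  moreover have "\<bar>expectation (\<lambda>\<omega>. f (Z n \<omega>)) - expectation (\<lambda>\<omega>. f (?X (t n) \<omega>))\<bar> \<le> L * expectation (\<lambda>_. h)"
  proof (rule expectation_value_profile_diff_le[OF f Z_M X_M])
    show "AE \<omega> in M. norm (Z n \<omega> - ?X (t n) \<omega>) \<le> h"
    proof (rule AE_I2)
      fix \<omega> assume "\<omega> \<in> space M"
      then have "norm (drift u (t (n - 1)) (t n) \<omega>) \<le> t n - t (n - 1)"
        by (rule norm_drift_le[OF u t(1,4)])
      also have "\<dots> \<le> h" using h by (cases n) (auto simp: t_def algebra_simps)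
      finally show "norm (Z n \<omega> - ?X (t n) \<omega>) \<le> h" by (simp add: Z_def)
    qed
  qed simp
  moreover have "c = 1 \<or> c = -1" using c by auto
  ultimately show ?thesis by (auto simp: prob_space t_def)
qed

end

section \<open>The feedback control and its time discretisation\<close>

text \<open>
  The left endpoint of the grid interval \<open>(k h, (k + 1) h]\<close> that contains \<open>s\<close>.
\<close>

definition grid :: "real \<Rightarrow> real \<Rightarrow> real" where
  "grid h s = h * (of_int \<lceil>s / h\<rceil> - 1)"

lemma borel_measurable_grid [measurable]: "grid h \<in> borel_measurable borel"
  unfolding grid_def[abs_def] by measurable

lemma grid_bounds:
  assumes "0 < h" "0 < s"
  shows "0 \<le> grid h s" "grid h s < s" "s - h \<le> grid h s"
proof -
  have "1 \<le> \<lceil>s / h\<rceil>" using assms by simp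
  then show "0 \<le> grid h s" using assms by (simp add: grid_def)
  have "(of_int \<lceil>s / h\<rceil> - 1) * h < s" "s \<le> of_int \<lceil>s / h\<rceil> * h"
    using ceiling_correct[of "s / h"] assms by (simp_all only: pos_less_divide_eq pos_divide_le_eq)
  then show "grid h s < s" "s - h \<le> grid h s"
    by (simp_all add: grid_def algebra_simps)
qed

lemma grid_eq:
  assumes "0 < h" "real k * h < s" "s \<le> real (Suc k) * h"
  shows "grid h s = real k * h"
proof -
  have "\<lceil>s / h\<rceil> = int (Suc k)"
    using assms by (intro ceiling_unique) (simp_all add: field_simps)
  then show ?thesis by (simp add: grid_def)
qed

text \<open>
  Both problems at once: \<open>c = 1\<close> is the minimisation and \<open>c = - 1\<close> the maximisation.
\<close>

locale feedback_solution = brownian_motion M F W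
  for M :: "'a measure" and F :: "real \<Rightarrow> 'a measure" and W :: "real \<Rightarrow> 'a \<Rightarrow> real ^ 'd::finite" +
  fixes c :: real and x :: "real ^ 'd" and Y :: "real \<Rightarrow> 'a \<Rightarrow> real ^ 'd"
  assumes c: "\<bar>c\<bar> = 1" and sol: "sgn_sde_solution M F W c x Y"
begin

definition feedback :: "real \<Rightarrow> 'a \<Rightarrow> real ^ 'd" where
  "feedback t \<omega> = c *\<^sub>R sgn (Y t \<omega>)"

lemma Y_jointly_measurable: "jointly_measurable M Y"
  and Y_measurable: "0 \<le> t \<Longrightarrow> Y t \<in> borel_measurable (F t)"
  using sol by (auto simp: sgn_sde_solution_def adapted_def)

lemma Y_measurable_M: "0 \<le> t \<Longrightarrow> Y t \<in> borel_measurable M"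
  by (rule measurable_F_M[OF _ Y_measurable])

lemma norm_feedback_le: "norm (feedback t \<omega>) \<le> 1"
  using c by (simp add: feedback_def norm_sgn)

lemma feedback_admissible: "feedback \<in> admissible_controls M F"
proof -
  have "jointly_measurable M feedback"
    using measurable_compose[OF Y_jointly_measurable[unfolded jointly_measurable_def], of "\<lambda>y. c *\<^sub>R sgn y" borel]
    by (simp add: jointly_measurable_def feedback_def split_beta')
  moreover have "adapted F feedback"
    using Y_measurable by (auto simp: adapted_def feedback_def[abs_def])
  ultimately show ?thesis
    by (simp add: admissible_controls_def norm_feedback_le)
qed

lemma Y_eq_controlled_process:
  "AE \<omega> in M. \<forall>t\<ge>0. Y t \<omega> = controlled_process W x feedback t \<omega>"
proof -
  have "AE \<omega> in M. \<forall>t\<ge>0.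
      Y t \<omega> = x + c *\<^sub>R set_lebesgue_integral lborel {0..t} (\<lambda>s. sgn (Y s \<omega>)) + W t \<omega>"
    using sol by (simp add: sgn_sde_solution_def)
  then show ?thesis
    by (simp add: controlled_process_def feedback_def[abs_def] set_integral_scaleR_right)
qed

lemma Y_nonzero:
  assumes "0 < t"
  shows "AE \<omega> in M. Y t \<omega> \<noteq> 0"
  using Y_eq_controlled_process controlled_process_nonzero[OF feedback_admissible assms, of x] assms
  by (auto elim: eventually_elim2)

text \<open>
  The discontinuity of \<open>sgn\<close> at the origin is harmless because the solution spends no time there.
\<close>

lemma Y_nonzero_AE_time: "AE \<omega> in M. AE s in lborel. 0 < s \<longrightarrow> Y s \<omega> \<noteq> 0"
proof -
  interpret TM: pair_sigma_finite lborel M ..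
  have [measurable]: "(\<lambda>z. Y (max (fst z) 0) (snd z)) \<in> borel_measurable (lborel \<Otimes>\<^sub>M M)"
    by (rule jointly_measurable_compose[OF Y_jointly_measurable]) auto
  have "AE s in lborel. AE \<omega> in M. 0 < s \<longrightarrow> 0 < norm (Y (max s 0) \<omega>)"
  proof (rule AE_I2)
    show "AE \<omega> in M. 0 < s \<longrightarrow> 0 < norm (Y (max s 0) \<omega>)" for s
      using Y_nonzero[of s] by (cases "0 < s") (auto simp: max_def)
  qed
  moreover have "{z \<in> space ((lborel :: real measure) \<Otimes>\<^sub>M M). 0 < fst z \<longrightarrow> 0 < norm (Y (max (fst z) 0) (snd z))}
      \<in> sets (lborel \<Otimes>\<^sub>M M)"
    by measurable
  ultimately have "AE \<omega> in M. AE s in lborel. 0 < s \<longrightarrow> 0 < norm (Y (max s 0) \<omega>)"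
    using TM.AE_commute[of "\<lambda>s \<omega>. 0 < s \<longrightarrow> 0 < norm (Y (max s 0) \<omega>)"] by blast
  then show ?thesis
  proof (rule eventually_mono)
    fix \<omega> assume "AE s in lborel. 0 < s \<longrightarrow> 0 < norm (Y (max s 0) \<omega>)"
    then show "AE s in lborel. 0 < s \<longrightarrow> Y s \<omega> \<noteq> 0"
      by eventually_elim (auto simp: max_def)
  qed
qed

text \<open>
  The rate at which the discrete optimum and the feedback drift can differ at time \<open>s\<close>: the first term
  is the error of \<open>radial_step_near\<close>, the second one is due to the change of the feedback since the last
  grid point.
\<close>

definition euler_defect :: "real \<Rightarrow> real \<Rightarrow> 'a \<Rightarrow> real" where
  "euler_defect h s \<omega> =
     indicator {y. norm y < h} (Y (grid h s) \<omega>) + norm (feedback s \<omega> - feedback (grid h s) \<omega>)"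

definition total_defect :: "real \<Rightarrow> real \<Rightarrow> 'a \<Rightarrow> real" where
  "total_defect h t \<omega> = (\<integral>s. indicator {0<..t} s * euler_defect h s \<omega> \<partial>lborel)"

lemma euler_defect_nonneg: "0 \<le> euler_defect h s \<omega>"
  by (simp add: euler_defect_def)

lemma euler_defect_le: "euler_defect h s \<omega> \<le> 3"
proof -
  have "norm (feedback s \<omega> - feedback (grid h s) \<omega>) \<le> 2"
    using norm_triangle_ineq4[of "feedback s \<omega>" "feedback (grid h s) \<omega>"]
      norm_feedback_le[of s \<omega>] norm_feedback_le[of "grid h s" \<omega>] by linarith
  moreover have "indicator {y. norm y < h} (Y (grid h s) \<omega>) \<le> (1 :: real)"
    by (rule indicator_le_1)
  ultimately show ?thesis unfolding euler_defect_def by linarith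
qed

lemma euler_defect_measurable:
  assumes h: "0 < h" and a: "0 \<le> a"
  shows "(\<lambda>(s, \<omega>). indicator {a<..t} s * euler_defect h s \<omega>) \<in> borel_measurable (lborel \<Otimes>\<^sub>M M)"
proof -
  have [measurable]: "(\<lambda>z. Y (max (fst z) 0) (snd z)) \<in> borel_measurable (lborel \<Otimes>\<^sub>M M)"
    "(\<lambda>z. Y (max (grid h (fst z)) 0) (snd z)) \<in> borel_measurable (lborel \<Otimes>\<^sub>M M)"
    by (rule jointly_measurable_compose[OF Y_jointly_measurable]; measurable)+
  let ?g = "\<lambda>z. indicator {a<..t} (fst z) * (indicator {y. norm y < h} (Y (max (grid h (fst z)) 0) (snd z))
      + norm (c *\<^sub>R sgn (Y (max (fst z) 0) (snd z)) - c *\<^sub>R sgn (Y (max (grid h (fst z)) 0) (snd z))))"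
  have "?g \<in> borel_measurable (lborel \<Otimes>\<^sub>M M)" by measurable
  also have "?g = (\<lambda>(s, \<omega>). indicator {a<..t} s * euler_defect h s \<omega>)"
    using grid_bounds(1)[OF h] a
    by (auto simp: fun_eq_iff euler_defect_def feedback_def indicator_def max_absorb1)
  finally show ?thesis .
qed

lemma euler_defect_integrable:
  assumes h: "0 < h" and a: "0 \<le> a" and \<omega>: "\<omega> \<in> space M"
  shows "integrable lborel (\<lambda>s. indicator {a<..t} s * euler_defect h s \<omega>)"
proof (rule Bochner_Integration.integrable_bound[OF integrable_mult_right[OF integrable_indicator_interval(1)[of a t], of 3]])
  show "(\<lambda>s. indicator {a<..t} s * euler_defect h s \<omega>) \<in> borel_measurable lborel"
    using measurable_compose[OF measurable_Pair2'[OF \<omega>] euler_defect_measurable[OF h a, of t]] by simp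
qed (use euler_defect_le[of h _ \<omega>] euler_defect_nonneg[of h _ \<omega>] in \<open>auto simp: indicator_def\<close>)

lemma total_defect_measurable: "0 < h \<Longrightarrow> total_defect h t \<in> borel_measurable M"
  using lborel.borel_measurable_lebesgue_integral[of "\<lambda>\<omega> s. indicator {0<..t} s * euler_defect h s \<omega>" M]
    measurable_compose[OF measurable_pair_swap' euler_defect_measurable[of h 0 t]]
  by (simp add: total_defect_def[abs_def] split_beta')

lemma total_defect_bounds:
  assumes "0 < h" "0 \<le> t" "\<omega> \<in> space M"
  shows "0 \<le> total_defect h t \<omega>" "total_defect h t \<omega> \<le> 3 * t"
proof -
  show "0 \<le> total_defect h t \<omega>"
    unfolding total_defect_def by (intro integral_nonneg_AE AE_I2 mult_nonneg_nonneg euler_defect_nonneg) simp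
  have "total_defect h t \<omega> \<le> (\<integral>s. 3 * indicator {0<..t} s \<partial>lborel)"
    unfolding total_defect_def using assms euler_defect_le[of h _ \<omega>]
    by (intro integral_mono euler_defect_integrable integrable_mult_right integrable_indicator_interval)
       (auto simp: indicator_def)
  then show "total_defect h t \<omega> \<le> 3 * t" using assms by simp
qed

lemma total_defect_integrable: "0 < h \<Longrightarrow> 0 \<le> t \<Longrightarrow> integrable M (total_defect h t)"
  using total_defect_bounds[of h t] total_defect_measurable
  by (intro integrable_const_bound[where B="3 * t"]) auto

text \<open>
  On one grid interval \<open>grid h\<close> is constant, so the first term of the defect integrates to \<open>h\<close> times its
  value there, and the second one bounds the change of drift when the feedback is frozen at the left
  endpoint. These are the two errors of a single time step.
\<close>

lemma total_defect_step:
  assumes h: "0 < h" and \<omega>: "\<omega> \<in> space M"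
  defines "t \<equiv> \<lambda>k. real k * h"
  shows "h * indicator {y. norm y < h} (Y (t k) \<omega>)
      + norm (drift feedback (t k) (t (Suc k)) \<omega> - h *\<^sub>R feedback (t k) \<omega>)
    \<le> total_defect h (t (Suc k)) \<omega> - total_defect h (t k) \<omega>"
proof -
  let ?I = "indicator {t k<..t (Suc k)} :: real \<Rightarrow> real"
  let ?b = "indicator {y. norm y < h} (Y (t k) \<omega>) :: real"
  have t: "0 \<le> t k" "t k \<le> t (Suc k)" "t (Suc k) - t k = h"
    using h by (auto simp: t_def algebra_simps)
  have gr: "grid h s = t k" if "s \<in> {t k<..t (Suc k)}" for s
    using grid_eq[OF h, of k s] that by (simp add: t_def)
  note ii = integrable_indicator_interval(2)[of "t k" "t (Suc k)"]
  have int_I: "(\<integral>s. ?I s \<partial>lborel) = h" using t by simp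
  note int_f = set_integrable_admissible_Ioc[OF feedback_admissible t(1) \<omega>, of "t (Suc k)"]
  have eq: "?I s * euler_defect h s \<omega> = ?b * ?I s + norm (?I s *\<^sub>R feedback s \<omega> - ?I s *\<^sub>R feedback (t k) \<omega>)" for s
    using gr[of s] by (auto simp: indicator_def euler_defect_def)
  have int_norm: "integrable lborel (\<lambda>s. norm (?I s *\<^sub>R feedback s \<omega> - ?I s *\<^sub>R feedback (t k) \<omega>))"
    using int_f ii by (intro integrable_norm Bochner_Integration.integrable_diff integrable_scaleR_left) auto
  have drift_eq: "drift feedback (t k) (t (Suc k)) \<omega> - h *\<^sub>R feedback (t k) \<omega>
      = (\<integral>s. ?I s *\<^sub>R feedback s \<omega> - ?I s *\<^sub>R feedback (t k) \<omega> \<partial>lborel)"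
    using int_f ii int_I by (simp add: drift_def set_lebesgue_integral_def)
  have "norm (drift feedback (t k) (t (Suc k)) \<omega> - h *\<^sub>R feedback (t k) \<omega>)
      \<le> (\<integral>s. norm (?I s *\<^sub>R feedback s \<omega> - ?I s *\<^sub>R feedback (t k) \<omega>) \<partial>lborel)"
    unfolding drift_eq by (rule integral_norm_bound)
  then have "h * ?b + norm (drift feedback (t k) (t (Suc k)) \<omega> - h *\<^sub>R feedback (t k) \<omega>)
      \<le> (\<integral>s. ?I s * euler_defect h s \<omega> \<partial>lborel)"
    unfolding eq using ii int_norm int_I by simp
  also have "\<dots> = total_defect h (t (Suc k)) \<omega> - total_defect h (t k) \<omega>"
  proof -
    have "?I s * euler_defect h s \<omega> 
        = indicator {0<..t (Suc k)} s * euler_defect h s \<omega> - indicator {0<..t k} s * euler_defect h s \<omega>" for s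
      using t by (auto simp: indicator_def)
    then show ?thesis
      unfolding total_defect_def using euler_defect_integrable[OF h _ \<omega>, of 0] by simp
  qed
  finally show ?thesis .
qed

text \<open>
  A telescoping argument: passing from \<open>t k\<close> to \<open>t (Suc k)\<close> replaces one more dynamic programming step
  by the evolution of \<open>Y\<close>, at a cost of at most \<open>L\<close> times the defect of that time step.
\<close>

lemma radial_value_close_to_feedback:
  fixes f :: "real ^ 'd \<Rightarrow> real"
  assumes f: "value_profile L f" and h: "0 < h"
  shows "\<bar>(radial_step c h ^^ n) f x - expectation (\<lambda>\<omega>. f (Y (real n * h) \<omega>))\<bar>
    \<le> L * expectation (total_defect h (real n * h))"
proof -
  define t where "t k = real k * h" for k
  have t: "0 \<le> t k" "t k < t (Suc k)" "t k \<le> t (Suc k)" "t (Suc k) - t k = h" for k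
    using h by (auto simp: t_def algebra_simps)
  let ?V = "\<lambda>k. (radial_step c h ^^ k) f"
  have V: "value_profile L (?V k)" for k by (rule value_profile_iterate[OF f h])
  have Y_M: "Y (t k) \<in> borel_measurable M" for k by (rule Y_measurable_M[OF t(1)])
  have L: "0 \<le> L" using value_profile_lipschitz[OF f, of "axis undefined 1" 0] by auto
  have "\<bar>?V n x - expectation (\<lambda>\<omega>. ?V (n - k) (Y (t k) \<omega>))\<bar> \<le> L * expectation (total_defect h (t k))"
    if "k \<le> n" for k
    using that
  proof (induction k)
    case 0
    have "AE \<omega> in M. Y 0 \<omega> = x"
      using Y_eq_controlled_process controlled_process_start[OF feedback_admissible, of x]
      by eventually_elim auto
    then have "expectation (\<lambda>\<omega>. ?V n (Y (t 0) \<omega>)) = expectation (\<lambda>_. ?V n x)"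
      using integrable_value_profile[OF V Y_M, of n 0] by (intro integral_cong_AE) (auto simp: t_def)
    then show ?case by (simp add: prob_space t_def total_defect_def[abs_def])
  next
    case (Suc k)
    define m where "m = n - Suc k"
    have m: "n - k = Suc m" using Suc by (simp add: m_def)
    \<comment> \<open>\<open>Z\<close> is an Euler step from \<open>Y (t k)\<close>; it lies between the optimal discrete step and \<open>Y (t (Suc k))\<close>.\<close>
    define g where "g \<omega> = Y (t k) \<omega> + (c * h) *\<^sub>R sgn (Y (t k) \<omega>)" for \<omega>
    define Z where "Z \<omega> = g \<omega> + (W (t (Suc k)) \<omega> - W (t k) \<omega>)" for \<omega>
    define b where "b \<omega> = (indicator {y. norm y < h} (Y (t k) \<omega>) :: real)" for \<omega>
    define e where "e \<omega> = norm (drift feedback (t k) (t (Suc k)) \<omega> - h *\<^sub>R feedback (t k) \<omega>)" for \<omega>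
    have [measurable]: "Y (t k) \<in> borel_measurable M" "Y (t (Suc k)) \<in> borel_measurable M" by (rule Y_M)+
    have g_F: "g \<in> borel_measurable (F (t k))"
      using Y_measurable[OF t(1)] unfolding g_def[abs_def] by measurable
    have [measurable]: "g \<in> borel_measurable M" by (rule measurable_F_M[OF t(1) g_F])
    have [measurable]: "W (t k) \<in> borel_measurable M" "W (t (Suc k)) \<in> borel_measurable M"
      by (rule W_measurable_M[OF t(1)])+
    have [measurable]: "Z \<in> borel_measurable M" unfolding Z_def[abs_def] by measurable
    have [measurable]: "drift feedback (t k) (t (Suc k)) \<in> borel_measurable M"
      by (rule measurable_F_M[OF t(1) drift_measurable[OF feedback_admissible t(1,3)]])
    have [measurable]: "feedback (t k) \<in> borel_measurable M"
      unfolding feedback_def[abs_def] by measurable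
    have int_b: "integrable M b"
      unfolding b_def by (rule integrable_const_bound[where B=1]) (auto simp: indicator_def)
    have int_e: "integrable M e"
    proof (rule integrable_const_bound[where B="2 * h"])
      show "AE \<omega> in M. norm (e \<omega>) \<le> 2 * h"
      proof (rule AE_I2)
        fix \<omega> assume "\<omega> \<in> space M"
        then have "norm (drift feedback (t k) (t (Suc k)) \<omega>) \<le> h"
          using norm_drift_le[OF feedback_admissible t(1,3), of \<omega>] t(4) by simp
        moreover have "norm (h *\<^sub>R feedback (t k) \<omega>) \<le> h"
          using norm_feedback_le[of "t k" \<omega>] h by simp
        ultimately show "norm (e \<omega>) \<le> 2 * h"
          unfolding e_def using norm_triangle_ineq4[of "drift feedback (t k) (t (Suc k)) \<omega>" "h *\<^sub>R feedback (t k) \<omega>"]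
          by simp
      qed
    qed (simp add: e_def[abs_def])
    have "\<bar>expectation (\<lambda>\<omega>. radial_step c h (?V m) (Y (t k) \<omega>)) - expectation (\<lambda>\<omega>. gauss_smooth h (?V m) (g \<omega>))\<bar>
        = \<bar>expectation (\<lambda>\<omega>. radial_step c h (?V m) (Y (t k) \<omega>) - gauss_smooth h (?V m) (g \<omega>))\<bar>"
      by (simp add: integrable_value_profile[OF value_profile_radial_step[OF V h]]
        integrable_value_profile[OF gauss_smooth_value_profile[OF V h]])
    also have "\<dots> \<le> expectation (\<lambda>\<omega>. \<bar>radial_step c h (?V m) (Y (t k) \<omega>) - gauss_smooth h (?V m) (g \<omega>)\<bar>)"
      by (rule integral_abs_bound)
    also have "\<dots> \<le> expectation (\<lambda>\<omega>. L * (h * b \<omega>))"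
      unfolding g_def b_def
      by (rule integral_mono'[OF _ radial_step_near[OF V h c]])
         (use L h int_b in \<open>auto simp: b_def[abs_def]\<close>)
    finally have 1: "\<bar>expectation (\<lambda>\<omega>. ?V (n - k) (Y (t k) \<omega>)) - expectation (\<lambda>\<omega>. ?V m (Z \<omega>))\<bar> \<le> L * (h * expectation b)"
      using expectation_value_profile_step[OF V t(1,2) g_F, of m] by (simp add: m Z_def t(4))
    have 2: "\<bar>expectation (\<lambda>\<omega>. ?V m (Z \<omega>)) - expectation (\<lambda>\<omega>. ?V m (Y (t (Suc k)) \<omega>))\<bar> \<le> L * expectation e"
    proof (rule expectation_value_profile_diff_le[OF V _ _ int_e])
      show "AE \<omega> in M. norm (Z \<omega> - Y (t (Suc k)) \<omega>) \<le> e \<omega>"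
        using Y_eq_controlled_process
      proof (rule AE_mp, intro AE_I2 impI)
        fix \<omega> assume \<omega>: "\<omega> \<in> space M" and eq: "\<forall>r\<ge>0. Y r \<omega> = controlled_process W x feedback r \<omega>"
        have "Y (t (Suc k)) \<omega> = Y (t k) \<omega> + drift feedback (t k) (t (Suc k)) \<omega> + (W (t (Suc k)) \<omega> - W (t k) \<omega>)"
          using controlled_process_step[OF feedback_admissible t(1)[of k] t(3)[of k] \<omega>, of x] eq t(1) by simp
        then have "Z \<omega> - Y (t (Suc k)) \<omega> = h *\<^sub>R feedback (t k) \<omega> - drift feedback (t k) (t (Suc k)) \<omega>"
          by (simp add: Z_def g_def feedback_def mult.commute)
        then show "norm (Z \<omega> - Y (t (Suc k)) \<omega>) \<le> e \<omega>"
          by (simp add: e_def norm_minus_commute)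
      qed
    qed measurable
    have "h * expectation b + expectation e = expectation (\<lambda>\<omega>. h * b \<omega> + e \<omega>)"
      using int_b int_e by simp
    also have "\<dots> \<le> expectation (\<lambda>\<omega>. total_defect h (t (Suc k)) \<omega> - total_defect h (t k) \<omega>)"
    proof (rule integral_mono)
      show "integrable M (\<lambda>\<omega>. h * b \<omega> + e \<omega>)" using int_b int_e by simp
      show "integrable M (\<lambda>\<omega>. total_defect h (t (Suc k)) \<omega> - total_defect h (t k) \<omega>)"
        by (intro Bochner_Integration.integrable_diff total_defect_integrable[OF h t(1)])
      show "h * b \<omega> + e \<omega> \<le> total_defect h (t (Suc k)) \<omega> - total_defect h (t k) \<omega>"
        if "\<omega> \<in> space M" for \<omega>
        unfolding b_def e_def t_def by (rule total_defect_step[OF h that])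
    qed
    also have "\<dots> = expectation (total_defect h (t (Suc k))) - expectation (total_defect h (t k))"
      using total_defect_integrable[OF h t(1)] by simp
    finally have "L * (h * expectation b) + L * expectation e
        \<le> L * (expectation (total_defect h (t (Suc k))) - expectation (total_defect h (t k)))"
      using L by (simp add: mult_left_mono flip: distrib_left)
    moreover have "\<bar>?V n x - expectation (\<lambda>\<omega>. ?V (n - k) (Y (t k) \<omega>))\<bar> \<le> L * expectation (total_defect h (t k))"
      using Suc by simp
    ultimately show ?case using 1 2 unfolding m_def right_diff_distrib by linarith
  qed
  from this[of n] show ?thesis by (simp add: t_def)
qed

lemma Y_grid_tendsto:
  assumes T: "0 < T"
  shows "AE \<omega> in M. \<forall>s>0. (\<lambda>n. Y (grid (T / real (Suc n)) s) \<omega>) \<longlonglongrightarrow> Y s \<omega>"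
  using AE_conjI[OF Y_eq_controlled_process continuous_W]
proof (rule AE_mp, intro AE_I2 impI allI)
  fix \<omega> s assume \<omega>: "\<omega> \<in> space M" and s: "(0 :: real) < s"
    and "(\<forall>t\<ge>0. Y t \<omega> = controlled_process W x feedback t \<omega>) \<and> continuous_on {0..} (\<lambda>t. W t \<omega>)"
  then have eq: "\<And>t. 0 \<le> t \<Longrightarrow> Y t \<omega> = controlled_process W x feedback t \<omega>"
    and cont: "continuous_on {0..} (\<lambda>t. W t \<omega>)" by auto
  define r where "r n = grid (T / real (Suc n)) s" for n
  have r: "0 \<le> r n" "r n < s" "s - T / real (Suc n) \<le> r n" for n
    using grid_bounds[of "T / real (Suc n)" s] s T by (simp_all add: r_def)
  have "(\<lambda>n. s - T * inverse (real (Suc n))) \<longlonglongrightarrow> s - T * 0"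
    by (intro tendsto_intros LIMSEQ_inverse_real_of_nat)
  then have r_lim: "r \<longlonglongrightarrow> s"
    by (intro tendsto_sandwich[of _ r _ "\<lambda>_. s"]) (use r in \<open>auto intro!: always_eventually less_imp_le simp: divide_inverse\<close>)
  have W_lim: "(\<lambda>n. W (r n) \<omega>) \<longlonglongrightarrow> W s \<omega>"
    by (rule continuous_on_tendsto_compose[OF cont r_lim]) (use r s in auto)
  have "(\<lambda>n. Y (r n) \<omega> - Y s \<omega>) \<longlonglongrightarrow> 0"
  proof (rule Lim_null_comparison)
    show "\<forall>\<^sub>F n in sequentially. norm (Y (r n) \<omega> - Y s \<omega>) \<le> (s - r n) + norm (W (r n) \<omega> - W s \<omega>)"
    proof (intro always_eventually allI)
      fix n
      have "norm (Y (r n) \<omega> - Y s \<omega>) = norm ((W (r n) \<omega> - W s \<omega>) - drift feedback (r n) s \<omega>)"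
        using controlled_process_step[OF feedback_admissible r(1) less_imp_le[OF r(2)] \<omega>, of x n] eq r(1) s by simp
      also have "\<dots> \<le> norm (W (r n) \<omega> - W s \<omega>) + norm (drift feedback (r n) s \<omega>)"
        by (rule norm_triangle_ineq4)
      also have "norm (drift feedback (r n) s \<omega>) \<le> s - r n"
        by (rule norm_drift_le[OF feedback_admissible r(1) less_imp_le[OF r(2)] \<omega>])
      finally show "norm (Y (r n) \<omega> - Y s \<omega>) \<le> (s - r n) + norm (W (r n) \<omega> - W s \<omega>)" by simp
    qed
    have "(\<lambda>n. (s - r n) + norm (W (r n) \<omega> - W s \<omega>)) \<longlonglongrightarrow> (s - s) + norm (W s \<omega> - W s \<omega>)"
      by (intro tendsto_intros r_lim W_lim)
    then show "(\<lambda>n. (s - r n) + norm (W (r n) \<omega> - W s \<omega>)) \<longlonglongrightarrow> 0" by simp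
  qed
  then show "(\<lambda>n. Y (grid (T / real (Suc n)) s) \<omega>) \<longlonglongrightarrow> Y s \<omega>"
    unfolding r_def by (rule LIM_zero_cancel)
qed

lemma euler_defect_tendsto_0:
  assumes Y: "(\<lambda>n. Y (grid (T / real (Suc n)) s) \<omega>) \<longlonglongrightarrow> Y s \<omega>" and Y0: "Y s \<omega> \<noteq> 0"
  shows "(\<lambda>n. euler_defect (T / real (Suc n)) s \<omega>) \<longlonglongrightarrow> 0"
proof -
  have h: "(\<lambda>n. T / real (Suc n)) \<longlonglongrightarrow> 0"
    using tendsto_mult_right_zero[OF LIMSEQ_inverse_real_of_nat, of T] by (simp add: divide_inverse)
  have "eventually (\<lambda>n. T / real (Suc n) < norm (Y (grid (T / real (Suc n)) s) \<omega>)) sequentially"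
  proof -
    have "(\<lambda>n. norm (Y (grid (T / real (Suc n)) s) \<omega>) - T / real (Suc n)) \<longlonglongrightarrow> norm (Y s \<omega>) - 0"
      by (intro tendsto_intros Y h)
    then have "eventually (\<lambda>n. 0 < norm (Y (grid (T / real (Suc n)) s) \<omega>) - T / real (Suc n)) sequentially"
      by (rule order_tendstoD) (use Y0 in simp)
    then show ?thesis by eventually_elim simp
  qed
  then have "eventually (\<lambda>n. norm (feedback s \<omega> - feedback (grid (T / real (Suc n)) s) \<omega>)
      = euler_defect (T / real (Suc n)) s \<omega>) sequentially"
    by eventually_elim (simp add: euler_defect_def)
  moreover have "(\<lambda>n. norm (feedback s \<omega> - feedback (grid (T / real (Suc n)) s) \<omega>)) \<longlonglongrightarrow> norm (feedback s \<omega> - feedback s \<omega>)"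
    unfolding feedback_def by (intro tendsto_intros tendsto_sgn Y Y0)
  ultimately show ?thesis by (simp add: tendsto_cong)
qed

text \<open>
  Dominated convergence, once in time and once over the probability space: along almost every path
  the feedback is continuous at almost every time.
\<close>

lemma expectation_total_defect_tendsto_0:
  assumes T: "0 < T"
  shows "(\<lambda>n. expectation (total_defect (T / real (Suc n)) T)) \<longlonglongrightarrow> 0"
proof -
  have h: "0 < T / real (Suc n)" for n using T by simp
  have "(\<lambda>n. expectation (total_defect (T / real (Suc n)) T)) \<longlonglongrightarrow> expectation (\<lambda>_. 0)"
  proof (rule integral_dominated_convergence)
    show "AE \<omega> in M. (\<lambda>n. total_defect (T / real (Suc n)) T \<omega>) \<longlonglongrightarrow> 0"
      using AE_conjI[OF Y_grid_tendsto[OF T] Y_nonzero_AE_time]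
    proof (rule AE_mp, intro AE_I2 impI, elim conjE)
      fix \<omega> assume \<omega>: "\<omega> \<in> space M"
        and lim: "\<forall>s>0. (\<lambda>n. Y (grid (T / real (Suc n)) s) \<omega>) \<longlonglongrightarrow> Y s \<omega>"
        and nz: "AE s in lborel. 0 < s \<longrightarrow> Y s \<omega> \<noteq> 0"
      have "(\<lambda>n. total_defect (T / real (Suc n)) T \<omega>) \<longlonglongrightarrow> (\<integral>s. (0 :: real) \<partial>(lborel :: real measure))"
        unfolding total_defect_def
      proof (rule integral_dominated_convergence)
        show "integrable lborel (\<lambda>s. 3 * indicator {0..T} s :: real)"
          by (intro integrable_mult_right integrable_indicator_interval)
        show "AE s in lborel. (\<lambda>n. indicator {0<..T} s * euler_defect (T / real (Suc n)) s \<omega>) \<longlonglongrightarrow> 0"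
          using nz
        proof eventually_elim
          case (elim s)
          then show ?case
            using euler_defect_tendsto_0[of T s \<omega>] lim by (cases "s \<in> {0<..T}") auto
        qed
        show "AE s in lborel. norm (indicator {0<..T} s * euler_defect (T / real (Suc n)) s \<omega>) \<le> 3 * indicator {0..T} s" for n
          using euler_defect_le euler_defect_nonneg by (intro AE_I2) (auto simp: indicator_def)
      qed (use euler_defect_integrable[OF h _ \<omega>, of 0] in auto)
      then show "(\<lambda>n. total_defect (T / real (Suc n)) T \<omega>) \<longlonglongrightarrow> 0" by simp
    qed
    show "AE \<omega> in M. norm (total_defect (T / real (Suc n)) T \<omega>) \<le> 3 * T" for n
      using total_defect_bounds[OF h] T by (intro AE_I2) auto
  qed (use total_defect_measurable[OF h] in auto)
  then show ?thesis by simp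
qed

section \<open>Optimality of the feedback control\<close>

text \<open>
  The discrete value \<open>(radial_step c h ^^ n) f x\<close> is a common yardstick: up to \<open>L * h\<close> it bounds what
  any control attains, and up to a vanishing error the feedback attains it.
\<close>

lemma feedback_optimal_lipschitz:
  fixes f :: "real ^ 'd \<Rightarrow> real"
  assumes f: "value_profile L f" and T: "0 < T" and u: "u \<in> admissible_controls M F"
  shows "c * expectation (\<lambda>\<omega>. f (Y T \<omega>)) \<le> c * expectation (\<lambda>\<omega>. f (controlled_process W x u T \<omega>))"
proof (rule LIMSEQ_le_const)
  let ?h = "\<lambda>n. T / real (Suc n)"
  let ?E = "c * expectation (\<lambda>\<omega>. f (controlled_process W x u T \<omega>))"
  have "(\<lambda>n. ?E + L * (T * inverse (real (Suc n))) + L * expectation (total_defect (?h n) T)) \<longlonglongrightarrow> ?E + L * (T * 0) + L * 0"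
    by (intro tendsto_intros LIMSEQ_inverse_real_of_nat expectation_total_defect_tendsto_0 T)
  then show "(\<lambda>n. ?E + L * ?h n + L * expectation (total_defect (?h n) T)) \<longlonglongrightarrow> ?E"
    by (simp add: divide_inverse)
  have "c * expectation (\<lambda>\<omega>. f (Y T \<omega>)) \<le> ?E + L * ?h n + L * expectation (total_defect (?h n) T)" for n
  proof -
    have h: "0 < ?h n" "real (Suc n) * ?h n = T" using T by auto
    note radial_value_bounds_controlled[OF f h(1) c u, of "Suc n" x, unfolded h(2)]
      radial_value_close_to_feedback[OF f h(1), of "Suc n", unfolded h(2)]
    moreover have "c = 1 \<or> c = -1" using c by auto
    ultimately show ?thesis by auto
  qed
  then show "\<exists>N. \<forall>n\<ge>N. c * expectation (\<lambda>\<omega>. f (Y T \<omega>))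
      \<le> ?E + L * ?h n + L * expectation (total_defect (?h n) T)" by blast
qed

text \<open>
  Lipschitz cutoffs that decrease to the indicator of the closed ball. They approximate from outside, so
  they are 1 on the bounding sphere and the limit is right even if that sphere has positive probability.
\<close>

lemma prob_le_as_limit:
  fixes X :: "'a \<Rightarrow> real ^ 'd"
  assumes [measurable]: "X \<in> borel_measurable M"
  shows "(\<lambda>n. expectation (\<lambda>\<omega>. max 0 (min 1 (1 - real n * (norm (X \<omega>) - \<epsilon>))))) \<longlonglongrightarrow> \<P>(\<omega> in M. norm (X \<omega>) \<le> \<epsilon>)"
proof -
  let ?g = "\<lambda>n r. max 0 (min 1 (1 - real n * (r - \<epsilon>)))"
  have lim: "(\<lambda>n. ?g n r) \<longlonglongrightarrow> indicator {..\<epsilon>} r" for r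
  proof (cases "r \<le> \<epsilon>")
    case True
    then have "?g n r = 1" for n by (simp add: mult_nonneg_nonpos)
    then show ?thesis using True by simp
  next
    case False
    then obtain N where N: "1 < real N * (r - \<epsilon>)" using reals_Archimedean3[of "r - \<epsilon>"] by auto
    have "?g n r = 0" if "N \<le> n" for n
    proof -
      have "real N * (r - \<epsilon>) \<le> real n * (r - \<epsilon>)" using that False by (intro mult_right_mono) auto
      then show ?thesis using N by auto
    qed
    then have "eventually (\<lambda>n. ?g n r = 0) sequentially" by (auto simp: eventually_sequentially)
    then show ?thesis using False by (simp add: tendsto_eventually)
  qed
  have "(\<lambda>n. expectation (\<lambda>\<omega>. ?g n (norm (X \<omega>)))) \<longlonglongrightarrow> expectation (\<lambda>\<omega>. indicator {..\<epsilon>} (norm (X \<omega>)))"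
    by (rule integral_dominated_convergence[where w="\<lambda>_. 1"]) (auto intro!: lim AE_I2)
  also have "expectation (\<lambda>\<omega>. indicator {..\<epsilon>} (norm (X \<omega>)))
      = expectation (\<lambda>\<omega>. indicator {\<omega> \<in> space M. norm (X \<omega>) \<le> \<epsilon>} \<omega>)"
    by (rule Bochner_Integration.integral_cong) (auto simp: indicator_def)
  also have "\<dots> = \<P>(\<omega> in M. norm (X \<omega>) \<le> \<epsilon>)"
    by (simp add: Int_def conj_commute)
  finally show ?thesis .
qed

lemma value_profile_cutoff:
  "value_profile (real n) (\<lambda>y :: real ^ 'd. max 0 (min 1 (1 - real n * (norm y - \<epsilon>))))"
  unfolding value_profile_def radially_decreasing_def
proof (intro conjI allI impI)
  fix y z :: "real ^ 'd"
  have "\<bar>real n * (norm y - \<epsilon>) - real n * (norm z - \<epsilon>)\<bar> = real n * \<bar>norm y - norm z\<bar>"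
    by (simp add: abs_mult flip: right_diff_distrib)
  also have "\<dots> \<le> real n * norm (y - z)"
    by (intro mult_left_mono norm_triangle_ineq3) simp
  finally show "\<bar>max 0 (min 1 (1 - real n * (norm y - \<epsilon>))) - max 0 (min 1 (1 - real n * (norm z - \<epsilon>)))\<bar>
      \<le> real n * norm (y - z)" by linarith
  show "max 0 (min 1 (1 - real n * (norm z - \<epsilon>))) \<le> max 0 (min 1 (1 - real n * (norm y - \<epsilon>)))"
    if "norm y \<le> norm z"
  proof -
    have "real n * (norm y - \<epsilon>) \<le> real n * (norm z - \<epsilon>)"
      using that by (intro mult_left_mono) auto
    then show ?thesis by linarith
  qed
qed auto

lemma feedback_optimal:
  assumes T: "0 < T" and u: "u \<in> admissible_controls M F"
  shows "c * \<P>(\<omega> in M. norm (controlled_process W x feedback T \<omega>) \<le> \<epsilon>)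
    \<le> c * \<P>(\<omega> in M. norm (controlled_process W x u T \<omega>) \<le> \<epsilon>)"
proof -
  have Y_M [measurable]: "Y T \<in> borel_measurable M" using T by (intro Y_measurable_M) simp
  have X_M: "controlled_process W x v T \<in> borel_measurable M" if "v \<in> admissible_controls M F" for v
    using controlled_process_measurable[OF that, of T x] T by (intro measurable_F_M[of T]) auto
  note [measurable] = X_M[OF feedback_admissible]
  have "c * \<P>(\<omega> in M. norm (Y T \<omega>) \<le> \<epsilon>) \<le> c * \<P>(\<omega> in M. norm (controlled_process W x u T \<omega>) \<le> \<epsilon>)"
  proof (rule LIMSEQ_le)
    show "\<exists>N. \<forall>n\<ge>N. c * expectation (\<lambda>\<omega>. max 0 (min 1 (1 - real n * (norm (Y T \<omega>) - \<epsilon>))))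
        \<le> c * expectation (\<lambda>\<omega>. max 0 (min 1 (1 - real n * (norm (controlled_process W x u T \<omega>) - \<epsilon>))))"
      using feedback_optimal_lipschitz[OF value_profile_cutoff T u] by blast
  qed (intro tendsto_mult_left prob_le_as_limit X_M u Y_M)+
  also have "\<P>(\<omega> in M. norm (Y T \<omega>) \<le> \<epsilon>) = \<P>(\<omega> in M. norm (controlled_process W x feedback T \<omega>) \<le> \<epsilon>)"
  proof (rule prob_eq_AE)
    show "AE \<omega> in M. norm (Y T \<omega>) \<le> \<epsilon> \<longleftrightarrow> norm (controlled_process W x feedback T \<omega>) \<le> \<epsilon>"
      using Y_eq_controlled_process by eventually_elim (use T in simp)
  qed measurable
  finally show ?thesis .
qed

end

theorem theorem3p13:
  fixes M :: "'a measure" and F :: "real \<Rightarrow> 'a measure"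
    and W Yplus Yminus :: "real \<Rightarrow> 'a \<Rightarrow> real ^ 'd::finite"
    and x :: "real ^ 'd" and T \<epsilon> :: real
    and ustar vstar :: "real \<Rightarrow> 'a \<Rightarrow> real ^ 'd"
  assumes "brownian_motion M F W"
    and "T > 0" and "\<epsilon> > 0"
    and "sgn_sde_solution M F W 1 x Yplus"
    and "sgn_sde_solution M F W (- 1) x Yminus"
  defines "ustar \<equiv> \<lambda>t \<omega>. sgn (Yplus t \<omega>)"
    and "vstar \<equiv> \<lambda>t \<omega>. - sgn (Yminus t \<omega>)"
  shows "ustar \<in> admissible_controls M F \<and>
      (INF u\<in>admissible_controls M F. \<P>(\<omega> in M. norm (controlled_process W x u T \<omega>) \<le> \<epsilon>))
        = \<P>(\<omega> in M. norm (controlled_process W x ustar T \<omega>) \<le> \<epsilon>)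
    \<and> vstar \<in> admissible_controls M F \<and>
      (SUP v\<in>admissible_controls M F. \<P>(\<omega> in M. norm (controlled_process W x v T \<omega>) \<le> \<epsilon>))
        = \<P>(\<omega> in M. norm (controlled_process W x vstar T \<omega>) \<le> \<epsilon>)"
proof -
  interpret brownian_motion M F W by fact
  interpret plus: feedback_solution M F W 1 x Yplus
    by unfold_locales (use assms in auto)
  interpret minus: feedback_solution M F W "-1" x Yminus
    by unfold_locales (use assms in auto)
  have ustar: "ustar = plus.feedback"
    by (simp add: ustar_def plus.feedback_def fun_eq_iff)
  have vstar: "vstar = minus.feedback"
    by (simp add: vstar_def minus.feedback_def fun_eq_iff)
  let ?P = "\<lambda>u. \<P>(\<omega> in M. norm (controlled_process W x u T \<omega>) \<le> \<epsilon>)"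
  have "(INF u\<in>admissible_controls M F. ?P u) = ?P ustar"
    using plus.feedback_optimal[OF \<open>T > 0\<close>] plus.feedback_admissible unfolding ustar
    by (intro cInf_eq_minimum) auto
  moreover have "(SUP u\<in>admissible_controls M F. ?P u) = ?P vstar"
    using minus.feedback_optimal[OF \<open>T > 0\<close>] minus.feedback_admissible unfolding vstar
    by (intro cSup_eq_maximum) auto
  ultimately show ?thesis
    using plus.feedback_admissible minus.feedback_admissible by (simp add: ustar vstar)
qed

end
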